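(* Let $A$ be a crossed product algebra of degree $n$ over a field $F$ with maximal subfield $M$ such that $M/F$ is a Galois field extension. Then $G=\mathrm{Gal}(M/F)$ is solvable if there exists a chain of subalgebras $$M=A_0\subset A_1\subset\dots\subset A_k=A$$ of $A$ which all have maximal subfield $M$, and are generalized cyclic algebras $$A_{i+1}\cong A_i[t_i;\tau_i]/A_i[t_i;\tau_i](t_i^{q_i}-c_i)$$ over their centers for all $i\in\{0,\dots,k-1\}$, where $q_i$ is a prime, $\tau_i$ is an $F$-automorphism of $A_i$ of inner order $q_i$ which restricts on $M$ to an automorphism $\sigma_{i+1}\in G$, and $c_i\in\mathrm{Fix}(\tau_i)^\times$.
   Context: All algebras are unital, associative and finite-dimensional. A central simple algebra over a field $Z$ has degree $n$ if its dimension over $Z$ is $n^2$; a maximal subfield of it is a subfield $M\supseteq Z$ with $[M:Z]=n$. A crossed product algebra over $F$ is a central simple $F$-algebra containing a maximal subfield that is Galois over $F$. For an automorphism $\tau$ of a ring $S$, $\mathrm{Fix}(\tau)=\{s\in S:\tau(s)=s\}$, and $\mathrm{Fix}(\tau)^\times$ denotes its invertible elements. For a ring $S$ and an automorphism $\tau$ of $S$, $S[t;\tau]$ is the twisted polynomial ring with $ta=\tau(a)t$ for $a\in S$. For monic $f\in S[t;\tau]$ of degree $m$, $S[t;\tau]/S[t;\tau]f$ denotes the set of twisted polynomials of degree $<m$ with multiplication $g\circ h=$ remainder of $gh$ under right division by $f$; when $f$ is invariant (i.e. $S[t;\tau]f$ is a two-sided ideal) this is the usual quotient ring. If $S$ is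 a finite-dimensional simple algebra over its center $Z$, $\tau\in\mathrm{Aut}(S)$ is such that $\tau|_Z$ has finite order $m$, and $f=t^m-d$ with $d\in\mathrm{Fix}(\tau)^\times$ is invariant, then $(S,\tau,d)=S[t;\tau]/S[t;\tau](t^m-d)$ is called a generalized cyclic algebra. The algebra $S$ is regarded as a subalgebra via constant polynomials, and the isomorphisms $A_{i+1}\cong A_i[t_i;\tau_i]/A_i[t_i;\tau_i](t_i^{q_i}-c_i)$ are understood to be compatible with the inclusion of $A_i$ in $A_{i+1}$. The inner order of an automorphism $\tau$ of $S$ is the smallest positive integer $m$ such that $\tau^m$ is an inner automorphism $z\mapsto uzu^{-1}$ of $S$. *)

theory Defs
  imports
    "HOL-Algebra.Embedded_Algebras"
    "HOL-Algebra.QuotRing"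
    "HOL-Algebra.UnivPoly"
    "HOL-Algebra.Bij"
    "HOL-Algebra.Solvable_Groups"
    "HOL-Computational_Algebra.Primes"
begin

text \<open>
  An algebra over a field \<open>F\<close> is a ring \<open>R\<close> together with a subfield \<open>F\<close> of \<open>R\<close> contained in
  the center of \<open>R\<close>. A subalgebra \<open>B\<close>, regarded as a ring of its own, is \<open>R\<lparr>carrier := B\<rparr>\<close>.
\<close>

section \<open>Central simple algebras\<close>

definition ring_center :: "('a, 'b) ring_scheme \<Rightarrow> 'a set" where
  "ring_center R = {z \<in> carrier R. \<forall>a \<in> carrier R. z \<otimes>\<^bsub>R\<^esub> a = a \<otimes>\<^bsub>R\<^esub> z}"

definition central_simple_algebra :: "('a, 'b) ring_scheme \<Rightarrow> 'a set \<Rightarrow> bool" where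
  "central_simple_algebra R Z \<longleftrightarrow>
     ring R \<and> subfield Z R \<and> ring_center R = Z \<and>
     (\<forall>I. ideal I R \<longrightarrow> I = {\<zero>\<^bsub>R\<^esub>} \<or> I = carrier R) \<and>
     (\<exists>d. ring.dimension R d Z (carrier R))"

definition csa_of_degree :: "('a, 'b) ring_scheme \<Rightarrow> 'a set \<Rightarrow> nat \<Rightarrow> bool" where
  "csa_of_degree R Z n \<longleftrightarrow>
     central_simple_algebra R Z \<and> ring.dimension R (n ^ 2) Z (carrier R)"

definition maximal_subfield :: "('a, 'b) ring_scheme \<Rightarrow> 'a set \<Rightarrow> 'a set \<Rightarrow> bool" where
  "maximal_subfield R Z M \<longleftrightarrow>
     subfield M R \<and> Z \<subseteq> M \<and> (\<exists>n. csa_of_degree R Z n \<and> ring.dimension R n Z M)"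

section \<open>Galois extensions\<close>

definition Galois_group :: "('a, 'b) ring_scheme \<Rightarrow> 'a set \<Rightarrow> 'a set \<Rightarrow> ('a \<Rightarrow> 'a) monoid" where
  "Galois_group R K L =
     BijGroup L \<lparr>carrier :=
       {\<sigma> \<in> Bij L. \<sigma> \<in> ring_iso (R\<lparr>carrier := L\<rparr>) (R\<lparr>carrier := L\<rparr>) \<and> (\<forall>x\<in>K. \<sigma> x = x)}\<rparr>"

text \<open>Finite Galois extensions: the base field is the fixed field of the automorphism group.\<close>

definition Galois_extension :: "('a, 'b) ring_scheme \<Rightarrow> 'a set \<Rightarrow> 'a set \<Rightarrow> bool" where
  "Galois_extension R K L \<longleftrightarrow>
     subfield K R \<and> subfield L R \<and> K \<subseteq> L \<and> (\<exists>d. ring.dimension R d K L) \<and>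
     {x \<in> L. \<forall>\<sigma> \<in> carrier (Galois_group R K L). \<sigma> x = x} = K"

definition crossed_product_algebra ::
    "('a, 'b) ring_scheme \<Rightarrow> 'a set \<Rightarrow> nat \<Rightarrow> 'a set \<Rightarrow> bool" where
  "crossed_product_algebra A F n M \<longleftrightarrow>
     csa_of_degree A F n \<and> maximal_subfield A F M \<and> Galois_extension A F M"

section \<open>Automorphisms of rings\<close>

definition Fix :: "('a, 'b) ring_scheme \<Rightarrow> ('a \<Rightarrow> 'a) \<Rightarrow> 'a set" where
  "Fix S \<tau> = {s \<in> carrier S. \<tau> s = s}"

definition inner_aut :: "('a, 'b) ring_scheme \<Rightarrow> ('a \<Rightarrow> 'a) \<Rightarrow> bool" where
  "inner_aut S \<phi> \<longleftrightarrow>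
     (\<exists>u \<in> Units S. \<forall>z \<in> carrier S. \<phi> z = u \<otimes>\<^bsub>S\<^esub> z \<otimes>\<^bsub>S\<^esub> inv\<^bsub>S\<^esub> u)"

definition has_inner_order :: "('a, 'b) ring_scheme \<Rightarrow> ('a \<Rightarrow> 'a) \<Rightarrow> nat \<Rightarrow> bool" where
  "has_inner_order S \<tau> m \<longleftrightarrow>
     0 < m \<and> inner_aut S (\<tau> ^^ m) \<and> (\<forall>k. 0 < k \<and> k < m \<longrightarrow> \<not> inner_aut S (\<tau> ^^ k))"

definition has_order_on :: "'a set \<Rightarrow> ('a \<Rightarrow> 'a) \<Rightarrow> nat \<Rightarrow> bool" where
  "has_order_on Z \<tau> m \<longleftrightarrow>
     0 < m \<and> (\<forall>z\<in>Z. (\<tau> ^^ m) z = z) \<and> (\<forall>k. 0 < k \<and> k < m \<longrightarrow> (\<exists>z\<in>Z. (\<tau> ^^ k) z \<noteq> z))"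

section \<open>Twisted polynomials\<close>

text \<open>
  Polynomials \<open>\<Sum> p i t\<^sup>i\<close> with coefficients written on the left; since \<open>t\<^sup>i b = \<tau>\<^sup>i(b) t\<^sup>i\<close>, only
  the multiplication differs from that of ordinary polynomials.
\<close>

definition twisted_poly ::
    "('a, 'b) ring_scheme \<Rightarrow> ('a \<Rightarrow> 'a) \<Rightarrow> ('a, nat \<Rightarrow> 'a) up_ring" where
  "twisted_poly S \<tau> =
     (UP S) \<lparr>mult := (\<lambda>p\<in>up S. \<lambda>q\<in>up S. \<lambda>n.
       \<Oplus>\<^bsub>S\<^esub>i \<in> {..n}. p i \<otimes>\<^bsub>S\<^esub> (\<tau> ^^ i) (q (n - i)))\<rparr>"

text \<open>
  \<open>S[t;\<tau>]/S[t;\<tau>]f\<close> for monic \<open>f\<close> of positive degree. The remainder is the unique \<open>r\<close> with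
  \<open>deg r < deg f\<close> and \<open>g = h f + r\<close> for some \<open>h\<close>. As \<open>deg S\<close> of the zero polynomial is 0, the
  condition on degrees includes the zero polynomial.
\<close>

definition twisted_rem ::
    "('a, 'b) ring_scheme \<Rightarrow> ('a \<Rightarrow> 'a) \<Rightarrow> (nat \<Rightarrow> 'a) \<Rightarrow> (nat \<Rightarrow> 'a) \<Rightarrow> (nat \<Rightarrow> 'a)" where
  "twisted_rem S \<tau> f g =
     (THE r. r \<in> carrier (twisted_poly S \<tau>) \<and> deg S r < deg S f \<and>
        (\<exists>h \<in> carrier (twisted_poly S \<tau>).
           g = (h \<otimes>\<^bsub>twisted_poly S \<tau>\<^esub> f) \<oplus>\<^bsub>twisted_poly S \<tau>\<^esub> r))"

definition twisted_quot ::
    "('a, 'b) ring_scheme \<Rightarrow> ('a \<Rightarrow> 'a) \<Rightarrow> (nat \<Rightarrow> 'a) \<Rightarrow> ('a, nat \<Rightarrow> 'a) up_ring" where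
  "twisted_quot S \<tau> f =
     (twisted_poly S \<tau>)
       \<lparr>carrier := {g \<in> carrier (twisted_poly S \<tau>). deg S g < deg S f},
        mult := (\<lambda>g h. twisted_rem S \<tau> f (g \<otimes>\<^bsub>twisted_poly S \<tau>\<^esub> h))\<rparr>"

definition invariant_poly ::
    "('a, 'b) ring_scheme \<Rightarrow> ('a \<Rightarrow> 'a) \<Rightarrow> (nat \<Rightarrow> 'a) \<Rightarrow> bool" where
  "invariant_poly S \<tau> f \<longleftrightarrow>
     ideal {g \<otimes>\<^bsub>twisted_poly S \<tau>\<^esub> f | g. g \<in> carrier (twisted_poly S \<tau>)} (twisted_poly S \<tau>)"

section \<open>Generalized cyclic algebras\<close>

definition twisted_binomial ::
    "('a, 'b) ring_scheme \<Rightarrow> ('a \<Rightarrow> 'a) \<Rightarrow> nat \<Rightarrow> 'a \<Rightarrow> (nat \<Rightarrow> 'a)" where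
  "twisted_binomial S \<tau> m d =
     monom (twisted_poly S \<tau>) \<one>\<^bsub>S\<^esub> m \<ominus>\<^bsub>twisted_poly S \<tau>\<^esub> monom (twisted_poly S \<tau>) d 0"

definition generalized_cyclic_data ::
    "('a, 'b) ring_scheme \<Rightarrow> ('a \<Rightarrow> 'a) \<Rightarrow> nat \<Rightarrow> 'a \<Rightarrow> bool" where
  "generalized_cyclic_data S \<tau> m d \<longleftrightarrow>
     central_simple_algebra S (ring_center S) \<and>
     \<tau> \<in> ring_iso S S \<and> has_order_on (ring_center S) \<tau> m \<and>
     d \<in> Units (S\<lparr>carrier := Fix S \<tau>\<rparr>) \<and>
     invariant_poly S \<tau> (twisted_binomial S \<tau> m d)"

text \<open>An isomorphism \<open>T \<cong> (S,\<tau>,d)\<close> that is the identity on the subring \<open>S\<close> of \<open>T\<close>.\<close>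

definition is_generalized_cyclic_over ::
    "('a, 'c) ring_scheme \<Rightarrow> ('a, 'b) ring_scheme \<Rightarrow> ('a \<Rightarrow> 'a) \<Rightarrow> nat \<Rightarrow> 'a \<Rightarrow> bool" where
  "is_generalized_cyclic_over T S \<tau> m d \<longleftrightarrow>
     generalized_cyclic_data S \<tau> m d \<and>
     (\<exists>\<phi> \<in> ring_iso T (twisted_quot S \<tau> (twisted_binomial S \<tau> m d)).
        \<forall>a \<in> carrier S. \<phi> a = monom (twisted_poly S \<tau>) a 0)"

end

theory Submission
  imports Defs
begin

text \<open>
  Let \<open>U\<^sub>i\<close> be the group of those elements of \<open>Gal(M/F)\<close> that are induced on \<open>M\<close> by conjugation
  with a unit of \<open>A\<^sub>i\<close>. Comparing coefficients of \<open>t\<^sub>i\<^sup>j\<close> in \<open>u x = \<sigma>(x) u\<close> for \<open>u \<in> A\<^sub>i\<^sub>+\<^sub>1\<close> shows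
  that \<open>U\<^sub>i\<^sub>+\<^sub>1\<close> is the union of the cosets \<open>U\<^sub>i \<sigma>\<^sub>i\<^sub>+\<^sub>1\<^sup>j\<close> with \<open>j < q\<^sub>i\<close>; as \<open>\<tau>\<^sub>i\<close> maps units of \<open>A\<^sub>i\<close> to units, \<open>\<sigma>\<^sub>i\<^sub>+\<^sub>1\<close>
  normalizes \<open>U\<^sub>i\<close>. Hence the derived group of \<open>U\<^sub>i\<^sub>+\<^sub>1\<close> lies in \<open>U\<^sub>i\<close>, and \<open>U\<^sub>0\<close> is trivial because \<open>M\<close> is
  commutative. Finally \<open>U\<^sub>k\<close> is the whole Galois group: an element of \<open>M\<close> fixed by \<open>U\<^sub>k\<close> commutes
  with \<open>M\<close> and every \<open>t\<^sub>i\<close>, so it is central in \<open>A\<close> and lies in \<open>F\<close>; now apply Artin's theorem.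
\<close>

section \<open>Division by twisted binomials\<close>

lemma carrier_UP: "carrier (UP S) = up S"
  and coeff_UP: "p \<in> up S \<Longrightarrow> coeff (UP S) p = p"
  and monom_UP: "a \<in> carrier S \<Longrightarrow> monom (UP S) a k = (\<lambda>n. if n = k then a else \<zero>\<^bsub>S\<^esub>)"
  by (simp_all add: UP_def)

text \<open>The twist changes only \<open>mult\<close>, while subtraction comes from the additive
  structure; so coefficients of the binomial can be found among ordinary polynomials.\<close>

lemma a_minus_twisted_poly: "p \<ominus>\<^bsub>twisted_poly S \<tau>\<^esub> r = p \<ominus>\<^bsub>UP S\<^esub> r"
  by (simp add: twisted_poly_def a_minus_def a_inv_def UP_def)

lemma twisted_poly_carrier: "carrier (twisted_poly S \<tau>) = up S"
  and twisted_poly_add: "p \<in> up S \<Longrightarrow> r \<in> up S \<Longrightarrow> p \<oplus>\<^bsub>twisted_poly S \<tau>\<^esub> r = (\<lambda>i. p i \<oplus>\<^bsub>S\<^esub> r i)"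
  and twisted_poly_monom: "monom (twisted_poly S \<tau>) = monom (UP S)"
  and twisted_poly_mult: "p \<in> up S \<Longrightarrow> r \<in> up S \<Longrightarrow> p \<otimes>\<^bsub>twisted_poly S \<tau>\<^esub> r =
        (\<lambda>n. \<Oplus>\<^bsub>S\<^esub>i \<in> {..n}. p i \<otimes>\<^bsub>S\<^esub> (\<tau> ^^ i) (r (n - i)))"
  by (simp_all add: twisted_poly_def UP_def)

text \<open>Products are computed on coefficient functions, without ring laws for
  \<open>twisted_poly S \<tau>\<close>; what enters is that every power of \<open>\<tau>\<close> is
  a ring endomorphism.\<close>

locale ring_endo = ring S for S (structure) +
  fixes \<tau> :: "'a \<Rightarrow> 'a"
  assumes endo: "\<tau> \<in> ring_hom S S"
begin

sublocale UP: UP_ring S "UP S"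
  by (unfold_locales)

lemma endo_pow_hom: "\<tau> ^^ i \<in> ring_hom S S"
proof (induction i)
  case (Suc i)
  then show ?case using ring_hom_trans[OF Suc endo] by (simp add: comp_def)
qed (auto simp: ring_hom_def)

lemma endo_pow_closed [simp]: "a \<in> carrier S \<Longrightarrow> (\<tau> ^^ i) a \<in> carrier S"
  using ring_hom_memE(1)[OF endo_pow_hom] .

lemma endo_pow_one [simp]: "(\<tau> ^^ i) \<one> = \<one>"
  using ring_hom_memE(4)[OF endo_pow_hom] .

lemma endo_pow_zero [simp]: "(\<tau> ^^ i) \<zero> = \<zero>"
  using ring_hom_zero[OF endo_pow_hom ring_axioms ring_axioms] .

text \<open>Degree bounds become vanishing of coefficients, the form used in the computations below.
  Positivity of \<open>q\<close> matters because the zero polynomial has degree 0.\<close>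

lemma deg_less_iff:
  assumes "p \<in> up S" "0 < q"
  shows "deg S p < q \<longleftrightarrow> (\<forall>n\<ge>q. p n = \<zero>)"
proof -
  have p: "p \<in> carrier (UP S)" "coeff (UP S) p = p" using assms by (simp_all add: carrier_UP coeff_UP)
  show ?thesis
  proof (intro iffI allI impI)
    fix n assume "deg S p < q" "q \<le> n"
    then have "coeff (UP S) p n = \<zero>" by (intro UP.deg_aboveD[OF _ p(1)]) linarith
    then show "p n = \<zero>" by (simp only: p(2))
  next
    assume *: "\<forall>n\<ge>q. p n = \<zero>"
    have "deg S p \<le> q - 1"
    proof (rule UP.deg_aboveI[OF _ p(1)])
      fix m assume "q - 1 < m"
      then have "p m = \<zero>" using * assms(2) by simp
      then show "coeff (UP S) p m = \<zero>" by (simp only: p(2))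
    qed
    then show "deg S p < q" using assms(2) by linarith
  qed
qed

lemma monom_in_up: "a \<in> carrier S \<Longrightarrow> (\<lambda>n. if n = m then a else \<zero>) \<in> up S"
  unfolding up_def by force

lemma finsum_single:
  assumes "i \<le> n" "\<And>j. j \<le> n \<Longrightarrow> g j \<in> carrier S" "\<And>j. j \<le> n \<Longrightarrow> j \<noteq> i \<Longrightarrow> g j = \<zero>"
  shows "(\<Oplus>j \<in> {..n::nat}. g j) = g i"
proof -
  have "(\<Oplus>j \<in> {..n}. g j) = (\<Oplus>j \<in> {..n}. if i = j then g j else \<zero>)"
    by (rule add.finprod_cong') (use assms in auto)
  also have "\<dots> = g i" using assms by (intro add.finprod_singleton) auto
  finally show ?thesis .
qed

lemma twisted_poly_monom_mult:
  assumes "a \<in> carrier S" "r \<in> up S"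
  shows "(monom (twisted_poly S \<tau>) a m \<otimes>\<^bsub>twisted_poly S \<tau>\<^esub> r) n =
    (if m \<le> n then a \<otimes> (\<tau> ^^ m) (r (n - m)) else \<zero>)"
proof -
  let ?g = "\<lambda>i. (if i = m then a else \<zero>) \<otimes> (\<tau> ^^ i) (r (n - i))"
  have r: "r k \<in> carrier S" for k using assms(2) by auto
  have "(monom (twisted_poly S \<tau>) a m \<otimes>\<^bsub>twisted_poly S \<tau>\<^esub> r) n = (\<Oplus>i \<in> {..n}. ?g i)"
    using assms by (simp add: twisted_poly_monom monom_UP twisted_poly_mult monom_in_up)
  also have "\<dots> = (if m \<le> n then a \<otimes> (\<tau> ^^ m) (r (n - m)) else \<zero>)"
  proof (cases "m \<le> n")
    case True
    then show ?thesis using finsum_single[OF True, of ?g] assms r by auto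
  next
    case False
    then show ?thesis using r by (auto intro!: add.finprod_one_eqI)
  qed
  finally show ?thesis .
qed

lemma twisted_poly_mult_const:
  assumes "a \<in> carrier S" "p \<in> up S"
  shows "(p \<otimes>\<^bsub>twisted_poly S \<tau>\<^esub> monom (twisted_poly S \<tau>) a 0) n = p n \<otimes> (\<tau> ^^ n) a"
proof -
  let ?g = "\<lambda>i. p i \<otimes> (\<tau> ^^ i) (if n - i = 0 then a else \<zero>)"
  have p: "p k \<in> carrier S" for k using assms(2) by auto
  have "(p \<otimes>\<^bsub>twisted_poly S \<tau>\<^esub> monom (twisted_poly S \<tau>) a 0) n = (\<Oplus>i \<in> {..n}. ?g i)"
    using assms by (simp add: twisted_poly_monom monom_UP twisted_poly_mult monom_in_up)
  also have "\<dots> = p n \<otimes> (\<tau> ^^ n) a"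
    using finsum_single[of n n ?g] assms p by auto
  finally show ?thesis .
qed

lemma twisted_binomial_eq:
  assumes "c \<in> carrier S" "0 < q"
  shows "twisted_binomial S \<tau> q c = (\<lambda>n. if n = q then \<one> else if n = 0 then \<ominus> c else \<zero>)"
proof -
  have "twisted_binomial S \<tau> q c = monom (UP S) \<one> q \<ominus>\<^bsub>UP S\<^esub> monom (UP S) c 0"
    by (simp add: twisted_binomial_def twisted_poly_monom a_minus_twisted_poly)
  \<comment> \<open>Elements of \<open>up S\<close> are their own coefficient functions; inserting
    \<open>coeff\<close> makes the rules for differences and monomials applicable.\<close>
  also have "\<dots> = coeff (UP S) (monom (UP S) \<one> q \<ominus>\<^bsub>UP S\<^esub> monom (UP S) c 0)"
    using assms by (intro coeff_UP[symmetric]) (simp flip: carrier_UP)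
  also have "\<dots> = (\<lambda>n. if n = q then \<one> else if n = 0 then \<ominus> c else \<zero>)"
    using assms by (auto simp: a_minus_def)
  finally show ?thesis .
qed

lemma
  assumes "c \<in> carrier S" "0 < q"
  shows binomial_up: "twisted_binomial S \<tau> q c \<in> up S"
    and deg_binomial: "\<one> \<noteq> \<zero> \<Longrightarrow> deg S (twisted_binomial S \<tau> q c) = q"
proof -
  let ?f = "twisted_binomial S \<tau> q c"
  show f: "?f \<in> up S"
    using assms unfolding twisted_binomial_eq[OF assms] by (auto simp: up_def intro!: exI[of _ q])
  show "deg S ?f = q" if "\<one> \<noteq> \<zero>"
    using that assms f
    by (intro antisym UP.deg_aboveI UP.deg_belowI) (auto simp: carrier_UP coeff_UP twisted_binomial_eq[OF assms])
qed

text \<open>The divisor is monic and \<open>(\<tau> ^^ d) \<one> = \<one>\<close>, so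
  \<open>h d\<close> reappears \<open>q\<close> places higher. The constant term
  \<open>\<ominus> c\<close> would meet only \<open>h (d + q)\<close>, which vanishes as
  \<open>0 < q\<close>. Here \<open>d\<close> may be any bound for the degree of
  \<open>h\<close>.\<close>

lemma mult_binomial_top:
  assumes "c \<in> carrier S" "0 < q" "h \<in> up S" "\<And>n. n > d \<Longrightarrow> h n = \<zero>"
  shows "(h \<otimes>\<^bsub>twisted_poly S \<tau>\<^esub> twisted_binomial S \<tau> q c) (d + q) = h d"
proof -
  let ?f = "twisted_binomial S \<tau> q c"
  let ?g = "\<lambda>i. h i \<otimes> (\<tau> ^^ i) (?f (d + q - i))"
  have h: "h k \<in> carrier S" for k using assms(3) by auto
  have f: "?f k \<in> carrier S" for k using binomial_up[OF assms(1,2)] by auto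
  have "(h \<otimes>\<^bsub>twisted_poly S \<tau>\<^esub> ?f) (d + q) = (\<Oplus>i \<in> {..d+q}. ?g i)"
    using assms binomial_up by (simp add: twisted_poly_mult)
  also have "\<dots> = ?g d"
  proof (rule finsum_single)
    show "?g j = \<zero>" if "j \<le> d + q" "j \<noteq> d" for j
    proof (cases "j > d")
      case False
      with that have "d + q - j \<noteq> q" "d + q - j \<noteq> 0" using assms(2) by linarith+
      then have "?f (d + q - j) = \<zero>" using twisted_binomial_eq[OF assms(1,2)] by simp
      then show ?thesis using h by simp
    qed (use f assms(4) in simp)
  qed (use h f in auto)
  also have "\<dots> = h d" using h twisted_binomial_eq[OF assms(1,2)] assms(2) by simp
  finally show ?thesis .
qed

text \<open>This evaluates the \<open>THE\<close> in \<open>twisted_rem\<close> once a single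
  division is exhibited. Uniqueness: for two divisions with quotients \<open>h\<close> and
  \<open>h'\<close>, the product of \<open>h - h'\<close> with the binomial vanishes from position
  \<open>q\<close> on, but a nonzero \<open>h - h'\<close> would show its leading coefficient
  there.\<close>

lemma twisted_rem_eqI:
  assumes c: "c \<in> carrier S" and q: "0 < q" and nz: "\<one> \<noteq> \<zero>"
    and h: "h \<in> up S" and r: "r \<in> up S" "\<And>n. n \<ge> q \<Longrightarrow> r n = \<zero>"
    and g: "g = (h \<otimes>\<^bsub>twisted_poly S \<tau>\<^esub> twisted_binomial S \<tau> q c) \<oplus>\<^bsub>twisted_poly S \<tau>\<^esub> r"
  shows "twisted_rem S \<tau> (twisted_binomial S \<tau> q c) g = r"
proof -
  let ?P = "twisted_poly S \<tau>" and ?f = "twisted_binomial S \<tau> q c"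
  have f: "?f \<in> up S" using binomial_up[OF c q] .
  have cl: "p n \<in> carrier S" if "p \<in> up S" for p n using that by auto
  have mcl: "(p \<otimes>\<^bsub>?P\<^esub> ?f) n \<in> carrier S" if "p \<in> up S" for p n
    using cl[OF that] cl[OF f] by (simp add: twisted_poly_mult[OF that f] Pi_def)
  \<comment> \<open>Addition in \<open>UP S\<close> is specified only on \<open>up S\<close>, so
    products must be shown to lie there before \<open>twisted_poly_add\<close> applies.\<close>
  have mup: "p \<otimes>\<^bsub>?P\<^esub> ?f \<in> up S" if p: "p \<in> up S" for p
  proof -
    obtain k where k: "\<And>n. n > k \<Longrightarrow> p n = \<zero>" using p unfolding up_def bound_def by auto
    have "bound \<zero> (k + q) (p \<otimes>\<^bsub>?P\<^esub> ?f)"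
    proof
      fix n assume n: "k + q < n"
      have "p i \<otimes> (\<tau> ^^ i) (?f (n - i)) = \<zero>" if "i \<le> n" for i
      proof (cases "i > k")
        case False
        with n have "n - i \<noteq> q" "n - i \<noteq> 0" by linarith+
        then have "?f (n - i) = \<zero>" using twisted_binomial_eq[OF c q] by simp
        then show ?thesis using cl[OF p] by simp
      qed (use k cl[OF f] in simp)
      then show "(p \<otimes>\<^bsub>?P\<^esub> ?f) n = \<zero>" using p f by (auto simp: twisted_poly_mult intro!: add.finprod_one_eqI)
    qed
    then show ?thesis using mcl[OF p] by (auto simp: up_def)
  qed
  have degs: "p \<in> up S \<Longrightarrow> deg S p < deg S ?f \<longleftrightarrow> (\<forall>n\<ge>q. p n = \<zero>)" for p
    using deg_binomial[OF c q nz] deg_less_iff[OF _ q] by simp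
  have uniq: "r' = r" if r': "r' \<in> up S" "\<And>n. n \<ge> q \<Longrightarrow> r' n = \<zero>" and h': "h' \<in> up S"
    and g': "g = (h' \<otimes>\<^bsub>?P\<^esub> ?f) \<oplus>\<^bsub>?P\<^esub> r'" for r' h'
  proof -
    have *: "(h' \<otimes>\<^bsub>?P\<^esub> ?f) n \<oplus> r' n = (h \<otimes>\<^bsub>?P\<^esub> ?f) n \<oplus> r n" for n
      using fun_cong[OF trans[OF sym[OF g'] g], of n] 
      by (simp add: twisted_poly_add[OF mup[OF h] r(1)] twisted_poly_add[OF mup[OF h'] r'(1)])
    let ?k = "\<lambda>n. h n \<ominus> h' n"
    have kup: "?k \<in> up S" using up_minus_closed[OF h h'] .
    \<comment> \<open>Distributivity in the left factor, checked coefficientwise from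
      \<open>h = (h - h') + h'\<close>.\<close>
    have kf: "(?k \<otimes>\<^bsub>?P\<^esub> ?f) n = (h \<otimes>\<^bsub>?P\<^esub> ?f) n \<ominus> (h' \<otimes>\<^bsub>?P\<^esub> ?f) n" for n
    proof -
      let ?e = "\<lambda>i. (\<tau> ^^ i) (?f (n - i))"
      have "(?k \<otimes>\<^bsub>?P\<^esub> ?f) n \<oplus> (h' \<otimes>\<^bsub>?P\<^esub> ?f) n = (\<Oplus>i \<in> {..n}. ?k i \<otimes> ?e i \<oplus> h' i \<otimes> ?e i)"
        using cl[OF kup] cl[OF h'] cl[OF f]
        by (simp add: twisted_poly_mult[OF kup f] twisted_poly_mult[OF h' f] finsum_addf Pi_def)
      also have "\<dots> = (\<Oplus>i \<in> {..n}. h i \<otimes> ?e i)"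
        using cl[OF h] cl[OF h'] cl[OF f]
        by (intro add.finprod_cong') (auto simp: l_distr[symmetric] a_minus_def a_assoc l_neg)
      also have "\<dots> = (h \<otimes>\<^bsub>?P\<^esub> ?f) n" using h f by (simp add: twisted_poly_mult)
      finally have "(?k \<otimes>\<^bsub>?P\<^esub> ?f) n \<oplus> (h' \<otimes>\<^bsub>?P\<^esub> ?f) n = (h \<otimes>\<^bsub>?P\<^esub> ?f) n" .
      then show ?thesis using mcl[OF kup] mcl[OF h'] mcl[OF h]
        by (simp add: a_minus_def add.inv_solve_right)
    qed
    have hi: "(h' \<otimes>\<^bsub>?P\<^esub> ?f) n = (h \<otimes>\<^bsub>?P\<^esub> ?f) n" if "n \<ge> q" for n
      using *[of n] r(2)[OF that] r'(2)[OF that] mcl[OF h] mcl[OF h'] by simp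
    have k0: "?k n = \<zero>" for n
    proof (rule ccontr)
      assume ne: "?k n \<noteq> \<zero>"
      obtain b where b: "\<And>m. m > b \<Longrightarrow> ?k m = \<zero>" using kup unfolding up_def bound_def by auto
      \<comment> \<open>The degree of the nonzero difference. Position \<open>?d + q\<close> is at
        least \<open>q\<close>, where both products agree, yet it carries
        \<open>?k ?d\<close>.\<close>
      let ?d = "GREATEST m. ?k m \<noteq> \<zero>"
      have bd: "\<And>m. ?k m \<noteq> \<zero> \<Longrightarrow> m \<le> b" using b not_le by blast
      have d: "?k ?d \<noteq> \<zero>" "\<And>m. m > ?d \<Longrightarrow> ?k m = \<zero>"
        using GreatestI_nat[of "\<lambda>m. ?k m \<noteq> \<zero>", OF ne bd] 
          Greatest_le_nat[of "\<lambda>m. ?k m \<noteq> \<zero>", OF _ bd] by (auto simp flip: not_le)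
      have "(?k \<otimes>\<^bsub>?P\<^esub> ?f) (?d + q) = ?k ?d" using mult_binomial_top[OF c q kup d(2)] by simp
      then show False using d(1) kf[of "?d + q"] hi[of "?d + q"] mcl[OF h] mcl[OF h']
        by (simp add: a_minus_def r_neg)
    qed
    have "h n = h' n" for n using k0[of n] cl[OF h] cl[OF h'] 
      by simp
    then have "h = h'" by blast
    then have "r' n = r n" for n
      using *[of n] mcl[OF h, of n] cl[OF r(1), of n] cl[OF r'(1), of n] by (metis r_neg1)
    then show ?thesis by blast
  qed
  show ?thesis unfolding twisted_rem_def
  proof (rule the_equality)
    show "r \<in> carrier ?P \<and> deg S r < deg S ?f \<and> (\<exists>h\<in>carrier ?P. g = (h \<otimes>\<^bsub>?P\<^esub> ?f) \<oplus>\<^bsub>?P\<^esub> r)"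
      using r h g degs[OF r(1)] by (auto simp: twisted_poly_carrier)
    show "r' = r" if "r' \<in> carrier ?P \<and> deg S r' < deg S ?f \<and>
        (\<exists>h\<in>carrier ?P. g = (h \<otimes>\<^bsub>?P\<^esub> ?f) \<oplus>\<^bsub>?P\<^esub> r')" for r'
      using that uniq degs by (auto simp: twisted_poly_carrier)
  qed
qed


section \<open>Multiplication in the quotient by a twisted binomial\<close>

lemma twisted_quot_carrier:
  assumes "c \<in> carrier S" "0 < q" "\<one> \<noteq> \<zero>"
  shows "carrier (twisted_quot S \<tau> (twisted_binomial S \<tau> q c)) = {p \<in> up S. \<forall>n\<ge>q. p n = \<zero>}"
  using assms deg_binomial[OF assms(1,2)] deg_less_iff[OF _ assms(2)]
  by (auto simp: twisted_quot_def twisted_poly_carrier)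

text \<open>Division with quotient zero: a product of degree below \<open>q\<close> is its own
  remainder.\<close>

lemma twisted_quot_mult_small:
  assumes c: "c \<in> carrier S" "0 < q" "\<one> \<noteq> \<zero>"
    and p: "p \<otimes>\<^bsub>twisted_poly S \<tau>\<^esub> r \<in> up S"
      "\<And>n. n \<ge> q \<Longrightarrow> (p \<otimes>\<^bsub>twisted_poly S \<tau>\<^esub> r) n = \<zero>"
  shows "p \<otimes>\<^bsub>twisted_quot S \<tau> (twisted_binomial S \<tau> q c)\<^esub> r = p \<otimes>\<^bsub>twisted_poly S \<tau>\<^esub> r"
proof -
  let ?P = "twisted_poly S \<tau>" and ?f = "twisted_binomial S \<tau> q c"
  have z: "(\<lambda>_. \<zero>) \<in> up S" by (auto simp: up_def)
  have f: "?f n \<in> carrier S" for n using binomial_up[OF c(1,2)] by auto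
  have "(\<lambda>_. \<zero>) \<otimes>\<^bsub>?P\<^esub> ?f = (\<lambda>_. \<zero>)"
    using f by (auto simp: twisted_poly_mult[OF z binomial_up[OF c(1,2)]] intro!: add.finprod_one_eqI)
  then have g: "p \<otimes>\<^bsub>?P\<^esub> r = ((\<lambda>_. \<zero>) \<otimes>\<^bsub>?P\<^esub> ?f) \<oplus>\<^bsub>?P\<^esub> (p \<otimes>\<^bsub>?P\<^esub> r)"
    using mem_upD[OF p(1)] by (simp add: twisted_poly_add[OF z p(1)])
  have "twisted_rem S \<tau> ?f (p \<otimes>\<^bsub>?P\<^esub> r) = p \<otimes>\<^bsub>?P\<^esub> r"
    by (rule twisted_rem_eqI[OF c z p g])
  then show ?thesis by (simp add: twisted_quot_def)
qed

text \<open>Multiplying by a constant does not raise the degree, so nothing is reduced. The two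
  rules make the comparison of coefficients possible: a constant on the left acts plainly, one on
  the right arrives at position \<open>n\<close> twisted by \<open>\<tau> ^^ n\<close>.\<close>

lemma twisted_quot_const_mult:
  assumes c: "c \<in> carrier S" "0 < q" "\<one> \<noteq> \<zero>" and a: "a \<in> carrier S"
    and p: "p \<in> carrier (twisted_quot S \<tau> (twisted_binomial S \<tau> q c))"
  shows "monom (twisted_poly S \<tau>) a 0 \<otimes>\<^bsub>twisted_quot S \<tau> (twisted_binomial S \<tau> q c)\<^esub> p = (\<lambda>n. a \<otimes> p n)"
    and "p \<otimes>\<^bsub>twisted_quot S \<tau> (twisted_binomial S \<tau> q c)\<^esub> monom (twisted_poly S \<tau>) a 0
      = (\<lambda>n. p n \<otimes> (\<tau> ^^ n) a)"
proof -
  let ?P = "twisted_poly S \<tau>"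
  have p': "p \<in> up S" "\<And>n. n \<ge> q \<Longrightarrow> p n = \<zero>" using p twisted_quot_carrier[OF c] by auto
  have b: "g \<in> up S" if "\<And>n. g n \<in> carrier S" "\<And>n. n \<ge> q \<Longrightarrow> g n = \<zero>" for g
    using that by (auto simp: up_def bound_def intro!: exI[of _ q])
  have l: "monom ?P a 0 \<otimes>\<^bsub>?P\<^esub> p = (\<lambda>n. a \<otimes> p n)"
    using twisted_poly_monom_mult[OF a p'(1), of 0] by auto
  have "monom ?P a 0 \<otimes>\<^bsub>?P\<^esub> p \<in> up S"
    unfolding l using a p'(2) mem_upD[OF p'(1)] by (intro b) auto
  then show "monom ?P a 0 \<otimes>\<^bsub>twisted_quot S \<tau> (twisted_binomial S \<tau> q c)\<^esub> p = (\<lambda>n. a \<otimes> p n)"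
    using twisted_quot_mult_small[OF c, of "monom ?P a 0" p] p'(2) a l by simp
  have r: "p \<otimes>\<^bsub>?P\<^esub> monom ?P a 0 = (\<lambda>n. p n \<otimes> (\<tau> ^^ n) a)"
    using twisted_poly_mult_const[OF a p'(1)] by auto
  have "p \<otimes>\<^bsub>?P\<^esub> monom ?P a 0 \<in> up S"
    unfolding r using a p'(2) mem_upD[OF p'(1)] by (intro b) auto
  then show "p \<otimes>\<^bsub>twisted_quot S \<tau> (twisted_binomial S \<tau> q c)\<^esub> monom ?P a 0 = (\<lambda>n. p n \<otimes> (\<tau> ^^ n) a)"
    using twisted_quot_mult_small[OF c, of p "monom ?P a 0"] p'(2) a r by simp
qed

text \<open>Division with quotient 1: \<open>t^q = 1 (t^q - c) + c\<close>. With
  \<open>i = 1\<close> or \<open>j = 1\<close> this leads to an inverse of \<open>t\<close> once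
  \<open>c\<close> is a unit.\<close>

lemma twisted_quot_monom_mult_monom:
  assumes c: "c \<in> carrier S" "0 < q" "\<one> \<noteq> \<zero>" and ij: "i + j = q"
  shows "monom (twisted_poly S \<tau>) \<one> i \<otimes>\<^bsub>twisted_quot S \<tau> (twisted_binomial S \<tau> q c)\<^esub>
    monom (twisted_poly S \<tau>) \<one> j = monom (twisted_poly S \<tau>) c 0"
proof -
  let ?P = "twisted_poly S \<tau>" and ?f = "twisted_binomial S \<tau> q c"
  have m: "monom ?P a k = (\<lambda>n. if n = k then a else \<zero>)" if "a \<in> carrier S" for a k
    using that by (simp add: twisted_poly_monom monom_UP)
  have mu: "monom ?P a k \<in> up S" if "a \<in> carrier S" for a k
    using that m monom_in_up by simp
  have f: "?f \<in> up S" using binomial_up[OF c(1,2)] .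
  have "(monom ?P \<one> 0 \<otimes>\<^bsub>?P\<^esub> ?f) n = ?f n" for n
    using twisted_poly_monom_mult[OF one_closed f, of 0 n] mem_upD[OF f] by simp
  then have f': "monom ?P \<one> 0 \<otimes>\<^bsub>?P\<^esub> ?f = ?f" by auto
  have "(monom ?P \<one> i \<otimes>\<^bsub>?P\<^esub> monom ?P \<one> j) n = (if n = q then \<one> else \<zero>)" for n
    using twisted_poly_monom_mult[OF one_closed mu[OF one_closed], of i j n] ij by (auto simp: m)
  also have "(if n = q then \<one> else \<zero>) = ((monom ?P \<one> 0 \<otimes>\<^bsub>?P\<^esub> ?f) \<oplus>\<^bsub>?P\<^esub> monom ?P c 0) n" for n
    using c unfolding f' twisted_poly_add[OF f mu[OF c(1)]] by (auto simp: m twisted_binomial_eq[OF c(1,2)] l_neg)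
  finally have "monom ?P \<one> i \<otimes>\<^bsub>?P\<^esub> monom ?P \<one> j = (monom ?P \<one> 0 \<otimes>\<^bsub>?P\<^esub> ?f) \<oplus>\<^bsub>?P\<^esub> monom ?P c 0"
    by blast
  then have "twisted_rem S \<tau> ?f (monom ?P \<one> i \<otimes>\<^bsub>?P\<^esub> monom ?P \<one> j) = monom ?P c 0"
    by (rule twisted_rem_eqI[OF c mu[OF one_closed] mu[OF c(1)], rotated 1]) (use c m in simp)
  then show ?thesis by (simp add: twisted_quot_def)
qed

end

text \<open>All that is used later of a generalized cyclic algebra: \<open>\<kappa> u j\<close> is
  the coefficient of \<open>t^j\<close> in \<open>u\<close>, and \<open>t\<close> is the element of
  \<open>C\<close> that corresponds to the variable.\<close>

lemma generalized_cyclic_coefficients: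
  fixes A :: "('a, 'b) ring_scheme"
  assumes A: "ring A" and B: "subring B A" and C: "subring C A" and BC: "B \<subseteq> C"
    and nz: "\<one>\<^bsub>A\<^esub> \<noteq> \<zero>\<^bsub>A\<^esub>" and q: "2 \<le> q"
    and gc: "is_generalized_cyclic_over (A\<lparr>carrier := C\<rparr>) (A\<lparr>carrier := B\<rparr>) \<tau> q c"
    and c: "c \<in> Units (A\<lparr>carrier := Fix (A\<lparr>carrier := B\<rparr>) \<tau>\<rparr>)"
  shows "\<exists>(\<kappa> :: 'a \<Rightarrow> nat \<Rightarrow> 'a) t.
    (\<forall>u\<in>C. \<forall>j. \<kappa> u j \<in> B) \<and>
    (\<forall>u\<in>C. u \<noteq> \<zero>\<^bsub>A\<^esub> \<longrightarrow> (\<exists>j<q. \<kappa> u j \<noteq> \<zero>\<^bsub>A\<^esub>)) \<and>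
    inj_on \<kappa> C \<and>
    (\<forall>x\<in>B. \<forall>u\<in>C. \<forall>j. \<kappa> (x \<otimes>\<^bsub>A\<^esub> u) j = x \<otimes>\<^bsub>A\<^esub> \<kappa> u j) \<and>
    (\<forall>x\<in>B. \<forall>u\<in>C. \<forall>j. \<kappa> (u \<otimes>\<^bsub>A\<^esub> x) j = \<kappa> u j \<otimes>\<^bsub>A\<^esub> (\<tau> ^^ j) x) \<and>
    t \<in> Units (A\<lparr>carrier := C\<rparr>) \<and>
    (\<forall>x\<in>B. t \<otimes>\<^bsub>A\<^esub> x = \<tau> x \<otimes>\<^bsub>A\<^esub> t)"
proof -
  interpret A: ring A by (rule A)
  let ?S = "A\<lparr>carrier := B\<rparr>" and ?T = "A\<lparr>carrier := C\<rparr>"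
  let ?P = "twisted_poly ?S \<tau>" and ?Q = "twisted_quot ?S \<tau> (twisted_binomial ?S \<tau> q c)"
  interpret T: ring ?T using A.subring_is_ring[OF C] .
  have "\<tau> \<in> ring_iso ?S ?S"
    using gc by (simp add: is_generalized_cyclic_over_def generalized_cyclic_data_def)
  then interpret E: ring_endo ?S \<tau>
    using A.subring_is_ring[OF B] by (simp add: ring_endo_def ring_endo_axioms_def ring_iso_def)
  obtain \<phi> where \<phi>: "\<phi> \<in> ring_iso ?T ?Q" and \<phi>B: "\<And>a. a \<in> B \<Longrightarrow> \<phi> a = monom ?P a 0"
    using gc by (auto simp: is_generalized_cyclic_over_def)
  have bij: "bij_betw \<phi> C (carrier ?Q)" using ring_iso_memE(5)[OF \<phi>] by simp
  have mult: "\<phi> (u \<otimes>\<^bsub>A\<^esub> v) = \<phi> u \<otimes>\<^bsub>?Q\<^esub> \<phi> v" if "u \<in> C" "v \<in> C" for u v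
    using ring_iso_memE(2)[OF \<phi>] that by simp
  \<comment> \<open>The inverse of \<open>c\<close> in the fixed ring lies in \<open>B\<close>,
    hence in \<open>C\<close>.\<close>
  have cB: "c \<in> B" and cU: "c \<in> Units ?T"
    using c BC by (auto simp: Units_def Fix_def)
  have q0: "0 < q" and nzS: "\<one>\<^bsub>?S\<^esub> \<noteq> \<zero>\<^bsub>?S\<^esub>" using q nz by auto
  have cS: "c \<in> carrier ?S" using cB by simp
  note tq = E.twisted_quot_carrier[OF cS q0 nzS]
  have \<phi>C: "\<phi> u \<in> carrier ?Q" if "u \<in> C" for u using bij that by (auto simp: bij_betw_def)
  have m: "monom ?P a k = (\<lambda>n. if n = k then a else \<zero>\<^bsub>A\<^esub>)" if "a \<in> B" for a k
    using that by (simp add: twisted_poly_monom monom_UP fun_eq_iff)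
  have oneB: "\<one>\<^bsub>A\<^esub> \<in> B" and zeroB: "\<zero>\<^bsub>A\<^esub> \<in> B" using subringE(2,3)[OF B] by auto
  have mQ: "monom ?P \<one>\<^bsub>A\<^esub> k \<in> carrier ?Q" if "k < q" for k
    using that oneB E.monom_in_up[of "\<one>\<^bsub>A\<^esub>" k] by (auto simp: tq m cong: if_cong)
  have const: "\<phi> (x \<otimes>\<^bsub>A\<^esub> u) j = x \<otimes>\<^bsub>A\<^esub> \<phi> u j" "\<phi> (u \<otimes>\<^bsub>A\<^esub> x) j = \<phi> u j \<otimes>\<^bsub>A\<^esub> (\<tau> ^^ j) x"
    if "x \<in> B" "u \<in> C" for x u j
    using that BC mult[of x u] mult[of u x] \<phi>B[of x] 
      E.twisted_quot_const_mult[OF cS q0 nzS, of x "\<phi> u"] \<phi>C[of u] by auto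
  \<comment> \<open>\<open>t\<close> is the preimage of the variable, which has degree below
    \<open>q\<close> because \<open>2 \<le> q\<close>; \<open>v\<close> is the preimage of its power
    \<open>q - 1\<close> and will be \<open>c t^-1\<close>.\<close>
  obtain t where t: "t \<in> C" "\<phi> t = monom ?P \<one>\<^bsub>A\<^esub> 1"
    using bij mQ[of 1] q by (auto simp: bij_betw_def image_iff) (metis imageE)
  obtain v where v: "v \<in> C" "\<phi> v = monom ?P \<one>\<^bsub>A\<^esub> (q - 1)"
    using bij mQ[of "q - 1"] q by (auto simp: bij_betw_def image_iff) (metis imageE)
  have inj: "u = w" if "u \<in> C" "w \<in> C" "\<phi> u = \<phi> w" for u w
    using bij that by (auto simp: bij_betw_def inj_on_def)
  have tv: "t \<otimes>\<^bsub>A\<^esub> v = c" "v \<otimes>\<^bsub>A\<^esub> t = c"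
    using mult[OF t(1) v(1)] mult[OF v(1) t(1)] t v q cB BC \<phi>B[OF cB] subringE(6)[OF C]
      E.twisted_quot_monom_mult_monom[OF cS q0 nzS, of 1 "q - 1"] E.twisted_quot_monom_mult_monom[OF cS q0 nzS, of "q - 1" 1]
    by (auto intro!: inj)
  \<comment> \<open>\<open>\<phi>\<close> itself serves as \<open>\<kappa>\<close>, since elements
    of the quotient are coefficient functions.\<close>
  show ?thesis
  proof (intro exI[of _ \<phi>] exI[of _ t] conjI ballI allI impI)
    show "\<phi> u j \<in> B" if "u \<in> C" for u j
      using \<phi>C[OF that] mem_upD[of "\<phi> u" ?S j] by (simp add: tq)
    show "inj_on \<phi> C" using bij by (simp add: bij_betw_def)
    show "\<exists>j<q. \<phi> u j \<noteq> \<zero>\<^bsub>A\<^esub>" if u: "u \<in> C" "u \<noteq> \<zero>\<^bsub>A\<^esub>" for u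
    proof (rule ccontr)
      assume "\<not> ?thesis"
      then have "\<phi> u = (\<lambda>_. \<zero>\<^bsub>A\<^esub>)" using \<phi>C[OF u(1)] by (auto simp: tq) (metis not_le)
      also have "\<dots> = \<phi> \<zero>\<^bsub>A\<^esub>" using \<phi>B[OF zeroB] m[OF zeroB] by auto
      finally show False using inj[OF u(1)] u(2) zeroB BC by auto
    qed
    show "t \<in> Units ?T"
    proof -
      obtain d where d: "d \<in> C" "c \<otimes>\<^bsub>A\<^esub> d = \<one>\<^bsub>A\<^esub>" "d \<otimes>\<^bsub>A\<^esub> c = \<one>\<^bsub>A\<^esub>"
        using cU by (auto simp: Units_def)
      \<comment> \<open>\<open>v d\<close> is a right and \<open>d v\<close> a left inverse of
        \<open>t\<close>; by associativity in \<open>C\<close> they coincide.\<close>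
      have "t \<otimes>\<^bsub>A\<^esub> (v \<otimes>\<^bsub>A\<^esub> d) = \<one>\<^bsub>A\<^esub>" "(d \<otimes>\<^bsub>A\<^esub> v) \<otimes>\<^bsub>A\<^esub> t = \<one>\<^bsub>A\<^esub>"
        using T.m_assoc[of t v d] T.m_assoc[of d v t] t(1) v(1) d tv by auto
      moreover have "v \<otimes>\<^bsub>A\<^esub> d \<in> C" "d \<otimes>\<^bsub>A\<^esub> v \<in> C" using v(1) d(1) subringE(6)[OF C] by auto
      ultimately show ?thesis
        using t(1) T.inv_unique[of "d \<otimes>\<^bsub>A\<^esub> v" t "v \<otimes>\<^bsub>A\<^esub> d"] by (auto simp: Units_def)
    qed
    show "t \<otimes>\<^bsub>A\<^esub> x = \<tau> x \<otimes>\<^bsub>A\<^esub> t" if x: "x \<in> B" for x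
    proof (rule inj)
      have \<tau>x: "\<tau> x \<in> B" using ring_hom_memE(1)[OF E.endo, of x] x by simp
      have cl: "x \<in> carrier A" "\<tau> x \<in> carrier A" using subringE(1)[OF B] x \<tau>x by auto
      have pz: "(\<tau> ^^ j) x \<in> carrier A" for j
        using E.endo_pow_closed[of x j] x subringE(1)[OF B] by auto
      \<comment> \<open>Both sides have coefficient \<open>\<tau> x\<close> at position 1 and zero
        elsewhere.\<close>
      show "\<phi> (t \<otimes>\<^bsub>A\<^esub> x) = \<phi> (\<tau> x \<otimes>\<^bsub>A\<^esub> t)"
        using const(1)[OF \<tau>x t(1)] const(2)[OF x t(1)] cl pz by (auto simp: t(2) m[OF oneB])
      show "t \<otimes>\<^bsub>A\<^esub> x \<in> C" "\<tau> x \<otimes>\<^bsub>A\<^esub> t \<in> C" using x \<tau>x BC t(1) subringE(6)[OF C] by auto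
    qed
  qed (use const in blast)+
qed

section \<open>Artin's theorem\<close>

text \<open>A list of pairs \<open>(x, y)\<close> stands for the element \<open>\<Sum> x \<otimes> y\<close> of \<open>R \<otimes> R\<close>.\<close>

primrec tensor_eval ::
    "('a, 'b) ring_scheme \<Rightarrow> ('a \<times> 'a) list \<Rightarrow> ('a \<Rightarrow> 'a) \<Rightarrow> ('a \<Rightarrow> 'a) \<Rightarrow> 'a" where
  "tensor_eval R [] r f = \<zero>\<^bsub>R\<^esub>"
| "tensor_eval R (p # ps) r f = r (fst p) \<otimes>\<^bsub>R\<^esub> f (snd p) \<oplus>\<^bsub>R\<^esub> tensor_eval R ps r f"

section \<open>Evaluation of tensors under pairs of maps\<close>

context cring
begin

lemma tensor_eval_closed:
  assumes "set ps \<subseteq> carrier R \<times> carrier R" "r \<in> carrier R \<rightarrow> carrier R" "f \<in> carrier R \<rightarrow> carrier R"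
  shows "tensor_eval R ps r f \<in> carrier R"
  using assms by (induction ps) (auto simp: Pi_iff)

lemma tensor_eval_cong:
  assumes "set ps \<subseteq> carrier R \<times> carrier R" "\<And>x. x \<in> carrier R \<Longrightarrow> r x = r' x"
    "\<And>x. x \<in> carrier R \<Longrightarrow> f x = f' x"
  shows "tensor_eval R ps r f = tensor_eval R ps r' f'"
  using assms(1) by (induction ps) (auto simp: assms(2,3))

lemma tensor_eval_append:
  assumes "set (ps @ qs) \<subseteq> carrier R \<times> carrier R"
    "r \<in> carrier R \<rightarrow> carrier R" "f \<in> carrier R \<rightarrow> carrier R"
  shows "tensor_eval R (ps @ qs) r f = tensor_eval R ps r f \<oplus> tensor_eval R qs r f"
  using assms(1)
proof (induction ps)
  case Nil
  then show ?case using assms tensor_eval_closed by simp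
next
  case (Cons p ps)
  moreover have "r (fst p) \<otimes> f (snd p) \<in> carrier R" using Cons.prems assms(2,3) by (auto simp: Pi_iff)
  ultimately show ?case using assms tensor_eval_closed[of ps] tensor_eval_closed[of qs]
    by (simp add: a_assoc)
qed

text \<open>Used with a trace function for \<open>f\<close>: as \<open>s\<close> fixes traces, only
  the first components are changed.\<close>

lemma hom_tensor_eval:
  assumes ps: "set ps \<subseteq> carrier R \<times> carrier R"
    "r \<in> carrier R \<rightarrow> carrier R" "f \<in> carrier R \<rightarrow> carrier R"
    and s: "s \<in> ring_hom R R"
  shows "s (tensor_eval R ps r f) = tensor_eval R ps (s \<circ> r) (s \<circ> f)"
  using ps(1)
proof (induction ps)
  case Nil
  then show ?case using ring_hom_zero[OF s] ring_axioms by simp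
next
  case (Cons p ps)
  have "r (fst p) \<in> carrier R" "f (snd p) \<in> carrier R" using Cons.prems ps(2,3) by auto
  then show ?case using Cons tensor_eval_closed[of ps r f] ps(2,3)
    by (simp add: ring_hom_memE[OF s])
qed

text \<open>Multiplication by the pure tensor of \<open>b\<close> and \<open>a\<close>; evaluation
  at a homomorphism \<open>f\<close> is multiplicative because \<open>R\<close> is
  commutative.\<close>

lemma tensor_eval_map:
  assumes ps: "set ps \<subseteq> carrier R \<times> carrier R" and f: "f \<in> ring_hom R R"
    and a: "a \<in> carrier R" "b \<in> carrier R"
  shows "tensor_eval R (map (\<lambda>(x, y). (b \<otimes> x, a \<otimes> y)) ps) (\<lambda>x. x) f
    = b \<otimes> f a \<otimes> tensor_eval R ps (\<lambda>x. x) f"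
  using ps
proof (induction ps)
  case Nil
  then show ?case using a ring_hom_memE(1)[OF f] by simp
next
  case (Cons p ps)
  obtain x y where p: "p = (x, y)" "x \<in> carrier R" "y \<in> carrier R" using Cons.prems by auto
  have "f a \<in> carrier R" "f y \<in> carrier R" using ring_hom_memE(1)[OF f] a p by auto
  moreover have "tensor_eval R ps (\<lambda>x. x) f \<in> carrier R"
    using Cons.prems ring_hom_memE(1)[OF f] by (intro tensor_eval_closed) auto
  ultimately show ?case using Cons p a by (simp add: ring_hom_memE[OF f] r_distr m_ac)
qed

text \<open>Linearity in the second map, which lets a tensor act term by term on a combination of
  elements of \<open>H\<close>.\<close>

lemma tensor_eval_sum:
  assumes ps: "set ps \<subseteq> carrier R \<times> carrier R" "r \<in> carrier R \<rightarrow> carrier R"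
    and H: "finite H" "\<And>g. g \<in> H \<Longrightarrow> g \<in> carrier R \<rightarrow> carrier R"
    and w: "\<And>g. g \<in> H \<Longrightarrow> w g \<in> carrier R"
  shows "tensor_eval R ps r (\<lambda>y. \<Oplus>g\<in>H. w g \<otimes> g y) = (\<Oplus>g\<in>H. w g \<otimes> tensor_eval R ps r g)"
  using ps(1)
proof (induction ps)
  case Nil
  then show ?case using w by (simp add: add.finprod_one_eqI)
next
  case (Cons p ps)
  obtain x y where p: "p = (x, y)" "x \<in> carrier R" "y \<in> carrier R" using Cons.prems by auto
  have rx: "r x \<in> carrier R" using p ps(2) by auto
  have gy: "g y \<in> carrier R" if "g \<in> H" for g using H(2)[OF that] p by auto
  have te: "tensor_eval R ps r g \<in> carrier R" if "g \<in> H" for g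
    using tensor_eval_closed[of ps r g] Cons.prems ps(2) H(2)[OF that] by simp
  have "tensor_eval R (p # ps) r (\<lambda>y. \<Oplus>g\<in>H. w g \<otimes> g y)
      = r x \<otimes> (\<Oplus>g\<in>H. w g \<otimes> g y) \<oplus> (\<Oplus>g\<in>H. w g \<otimes> tensor_eval R ps r g)"
    using Cons p by simp
  also have "\<dots> = (\<Oplus>g\<in>H. r x \<otimes> (w g \<otimes> g y)) \<oplus> (\<Oplus>g\<in>H. w g \<otimes> tensor_eval R ps r g)"
    using rx gy w H(1) by (subst finsum_rdistr) auto
  also have "\<dots> = (\<Oplus>g\<in>H. r x \<otimes> (w g \<otimes> g y) \<oplus> w g \<otimes> tensor_eval R ps r g)"
    using rx gy w te by (intro finsum_addf[symmetric]) auto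
  also have "\<dots> = (\<Oplus>g\<in>H. w g \<otimes> tensor_eval R (p # ps) r g)"
    using rx gy w te p by (intro add.finprod_cong') (auto simp: r_distr m_lcomm)
  finally show ?case .
qed

end

section \<open>Independence of homomorphisms and fixed fields\<close>

context field
begin

text \<open>A tensor form of Dedekind independence. Given \<open>k\<close> in \<open>T\<close>,
  choose \<open>a\<close> with \<open>s a \<noteq> k a\<close> and let \<open>d\<close> be the
  inverse of \<open>s a - k a\<close>. The pair \<open>(d, a)\<close> minus the pair
  \<open>(d k(a), 1)\<close> evaluates at \<open>f\<close> to \<open>d (f a - k a)\<close>, which is
  1 at \<open>s\<close> and 0 at \<open>k\<close>. The product of these tensors over all
  \<open>k\<close> separates \<open>s\<close> from \<open>T\<close>.\<close>

lemma separating_tensor: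
  assumes T: "finite T" "T \<subseteq> ring_hom R R" and s: "s \<in> ring_hom R R"
    and ne: "\<And>h. h \<in> T \<Longrightarrow> \<exists>a\<in>carrier R. s a \<noteq> h a"
  obtains ps where "set ps \<subseteq> carrier R \<times> carrier R" "tensor_eval R ps (\<lambda>x. x) s = \<one>"
    "\<And>h. h \<in> T \<Longrightarrow> tensor_eval R ps (\<lambda>x. x) h = \<zero>"
proof -
  have "\<exists>ps. set ps \<subseteq> carrier R \<times> carrier R \<and> tensor_eval R ps (\<lambda>x. x) s = \<one> \<and>
    (\<forall>h\<in>T. tensor_eval R ps (\<lambda>x. x) h = \<zero>)"
    using T ne
  proof (induction T rule: finite_induct)
    case empty
    show ?case using ring_hom_memE(4)[OF s] by (intro exI[of _ "[(\<one>, \<one>)]"]) simp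
  next
    case (insert k T)
    then obtain ps where ps: "set ps \<subseteq> carrier R \<times> carrier R" "tensor_eval R ps (\<lambda>x. x) s = \<one>"
      "\<And>h. h \<in> T \<Longrightarrow> tensor_eval R ps (\<lambda>x. x) h = \<zero>" by auto
    obtain a where a: "a \<in> carrier R" "s a \<noteq> k a" using insert.prems by blast
    have k: "k \<in> ring_hom R R" using insert.prems by auto
    have cl: "s a \<in> carrier R" "k a \<in> carrier R" using ring_hom_memE(1)[OF s a(1)] ring_hom_memE(1)[OF k a(1)] .
    define d where "d = inv (s a \<ominus> k a)"
    have nz: "s a \<ominus> k a \<in> carrier R - {\<zero>}" using cl a(2) by simp
    then have d: "d \<in> carrier R" "d \<otimes> (s a \<ominus> k a) = \<one>"
      unfolding d_def using field_Units Units_inv_closed Units_l_inv by blast+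
    define qs where "qs = map (\<lambda>(x, y). (d \<otimes> x, a \<otimes> y)) ps
      @ map (\<lambda>(x, y). (\<ominus> (d \<otimes> k a) \<otimes> x, \<one> \<otimes> y)) ps"
    have qs: "set qs \<subseteq> carrier R \<times> carrier R" using ps(1) d a cl by (auto simp: qs_def)
    have ev: "tensor_eval R qs (\<lambda>x. x) f = d \<otimes> (f a \<ominus> k a) \<otimes> tensor_eval R ps (\<lambda>x. x) f"
      if f: "f \<in> ring_hom R R" for f
    proof -
      have fc: "f \<in> carrier R \<rightarrow> carrier R" using ring_hom_memE(1)[OF f] by auto
      have fa: "f a \<in> carrier R" using fc a by auto
      have t: "tensor_eval R ps (\<lambda>x. x) f \<in> carrier R" using ps(1) fc by (intro tensor_eval_closed) auto
      have "tensor_eval R qs (\<lambda>x. x) f = d \<otimes> f a \<otimes> tensor_eval R ps (\<lambda>x. x) f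
          \<oplus> \<ominus> (d \<otimes> k a) \<otimes> f \<one> \<otimes> tensor_eval R ps (\<lambda>x. x) f"
        unfolding qs_def tensor_eval_append[OF qs[unfolded qs_def] funcset_id fc]
        using d cl by (simp only: tensor_eval_map[OF ps(1) f] a one_closed m_closed a_inv_closed)
      also have "\<dots> = d \<otimes> (f a \<ominus> k a) \<otimes> tensor_eval R ps (\<lambda>x. x) f"
        using fa t d(1) cl by (simp add: ring_hom_memE(4)[OF f] a_minus_def r_distr l_distr l_minus r_minus)
      finally show ?thesis .
    qed
    have "tensor_eval R qs (\<lambda>x. x) s = \<one>" using ev[OF s] ps(2) d by simp
    moreover have "tensor_eval R qs (\<lambda>x. x) h = \<zero>" if "h \<in> insert k T" for h
    proof (cases "h = k")
      case True
      have "k \<in> carrier R \<rightarrow> carrier R" using ring_hom_memE(1)[OF k] by auto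
      then have "tensor_eval R ps (\<lambda>x. x) k \<in> carrier R" using ps(1) by (intro tensor_eval_closed) auto
      then show ?thesis using True ev[OF k] cl d by (simp add: a_minus_def r_neg)
    next
      case False
      then have h: "h \<in> T" "h \<in> ring_hom R R" using that insert.prems by auto
      then have "h a \<in> carrier R" using ring_hom_memE(1)[OF h(2) a(1)] by simp
      then show ?thesis using ev[OF h(2)] ps(3)[OF h(1)] d cl by simp
    qed
    ultimately show ?case using qs by blast
  qed
  then show ?thesis using that by blast
qed

text \<open>
  Artin's theorem: a tensor separating the identity from the rest of \<open>H\<close> expresses every
  element through traces, so that any \<open>s\<close> fixing the traces is a linear combination of \<open>H\<close>.
\<close>

lemma Artin_fixed_field:
  assumes fin: "finite H" and hom: "H \<subseteq> ring_hom R R" and ext: "H \<subseteq> extensional (carrier R)"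
    and one: "(\<lambda>x\<in>carrier R. x) \<in> H"
    and bij: "\<And>k. k \<in> H \<Longrightarrow> bij_betw (compose (carrier R) k) H H"
    and s: "s \<in> ring_hom R R" "s \<in> extensional (carrier R)"
    and fixed: "\<And>x. x \<in> carrier R \<Longrightarrow> (\<And>h. h \<in> H \<Longrightarrow> h x = x) \<Longrightarrow> s x = x"
  shows "s \<in> H"
proof (rule ccontr)
  assume sH: "s \<notin> H"
  define e where "e = (\<lambda>x\<in>carrier R. x)"
  have cl: "h \<in> carrier R \<rightarrow> carrier R" if "h \<in> ring_hom R R" for h
    using ring_hom_memE(1)[OF that] by auto
  have clH: "h x \<in> carrier R" if "h \<in> H" "x \<in> carrier R" for h x
    using ring_hom_memE(1)[of h R R x] hom that by blast
  have ne: "\<exists>a\<in>carrier R. f a \<noteq> h a"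
    if "f \<in> extensional (carrier R)" "h \<in> extensional (carrier R)" "f \<noteq> h" for f h
    using that extensionalityI[of f "carrier R" h] by blast
  \<comment> \<open>This tensor, separating the identity from the rest of \<open>H\<close>, will
    recover each \<open>w\<close> from its traces.\<close>
  obtain ps where ps: "set ps \<subseteq> carrier R \<times> carrier R" "tensor_eval R ps (\<lambda>x. x) e = \<one>"
    "\<And>h. h \<in> H - {e} \<Longrightarrow> tensor_eval R ps (\<lambda>x. x) h = \<zero>"
  proof (rule separating_tensor[of "H - {e}" e])
    show "\<exists>a\<in>carrier R. e a \<noteq> h a" if "h \<in> H - {e}" for h
      using that ext one[folded e_def] by (intro ne) blast+
  qed (use fin hom one in \<open>auto simp: e_def\<close>)
  \<comment> \<open>This one separates \<open>s\<close> from all of \<open>H\<close>, which is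
    possible because \<open>s \<notin> H\<close>; it refutes a linear relation.\<close>
  obtain qs where qs: "set qs \<subseteq> carrier R \<times> carrier R" "tensor_eval R qs (\<lambda>x. x) s = \<one>"
    "\<And>h. h \<in> H \<Longrightarrow> tensor_eval R qs (\<lambda>x. x) h = \<zero>"
  proof (rule separating_tensor[of H s])
    show "\<exists>a\<in>carrier R. s a \<noteq> h a" if "h \<in> H" for h
      using that ext s(2) sH by (intro ne) auto
  qed (use fin hom s in auto)
  let ?tr = "\<lambda>w y. \<Oplus>g\<in>H. g w \<otimes> g y"
  define z where "z g = tensor_eval R ps s g" for g
  have zc: "z g \<in> carrier R" if "g \<in> H" for g
    unfolding z_def using ps(1) cl s(1) hom that by (intro tensor_eval_closed) auto
  have tr_closed: "?tr w y \<in> carrier R" if "w \<in> carrier R" "y \<in> carrier R" for w y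
    using that clH by (intro finsum_closed) auto
  \<comment> \<open>Composition with \<open>k\<close> permutes \<open>H\<close>, hence the summands
    of the trace.\<close>
  have tr_fixed: "s (?tr w y) = ?tr w y" if wy: "w \<in> carrier R" "y \<in> carrier R" for w y
  proof (rule fixed[OF tr_closed[OF wy]])
    fix k assume k: "k \<in> H"
    then have kh: "k \<in> ring_hom R R" using hom by auto
    interpret k: ring_hom_cring R R k using kh by unfold_locales
    have "k (?tr w y) = (\<Oplus>g\<in>H. k (g w \<otimes> g y))"
      using wy clH by (subst k.hom_finsum) (auto simp: comp_def)
    also have "\<dots> = (\<Oplus>g\<in>H. compose (carrier R) k g w \<otimes> compose (carrier R) k g y)"
      using wy clH by (intro add.finprod_cong') (auto simp: compose_def)
    also have "\<dots> = (\<Oplus>g\<in>compose (carrier R) k ` H. g w \<otimes> g y)"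
      using bij[OF k] wy clH by (intro add.finprod_reindex[symmetric]) (auto simp: bij_betw_def)
    also have "\<dots> = ?tr w y" using bij[OF k] by (simp add: bij_betw_def)
    finally show "k (?tr w y) = ?tr w y" .
  qed
  \<comment> \<open>If \<open>ps\<close> consists of pairs \<open>(x_i, y_i)\<close>, then
    \<open>w\<close> is the sum of the \<open>x_i tr(w y_i)\<close>, since after exchanging the sums
    only \<open>g = e\<close> survives. Applying \<open>s\<close> leaves the traces and turns
    \<open>x_i\<close> into \<open>s x_i\<close>.\<close>
  have lin: "s w = (\<Oplus>g\<in>H. z g \<otimes> g w)" if w: "w \<in> carrier R" for w
  proof -
    have "tensor_eval R ps (\<lambda>x. x) (?tr w) = (\<Oplus>g\<in>H. g w \<otimes> tensor_eval R ps (\<lambda>x. x) g)"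
      using ps(1) fin clH w by (intro tensor_eval_sum) auto
    also have "\<dots> = (\<Oplus>g\<in>H. if e = g then g w else \<zero>)"
      using ps(2,3) clH w by (intro add.finprod_cong') auto
    also have "\<dots> = w"
      using add.finprod_singleton[of e H "\<lambda>g. g w"] one fin clH w by (auto simp: e_def)
    finally have "s w = s (tensor_eval R ps (\<lambda>x. x) (?tr w))" by simp
    also have "\<dots> = tensor_eval R ps (s \<circ> (\<lambda>x. x)) (s \<circ> ?tr w)"
      using ps(1) tr_closed w s(1) by (intro hom_tensor_eval) auto
    also have "\<dots> = tensor_eval R ps s (?tr w)"
      using ps(1) tr_fixed w by (intro tensor_eval_cong) auto
    also have "\<dots> = (\<Oplus>g\<in>H. g w \<otimes> z g)"
      unfolding z_def using ps(1) fin clH w cl[OF s(1)] by (intro tensor_eval_sum) auto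
    also have "\<dots> = (\<Oplus>g\<in>H. z g \<otimes> g w)"
      using zc clH w by (intro add.finprod_cong') (auto simp: m_comm)
    finally show ?thesis .
  qed
  \<comment> \<open>\<open>qs\<close> evaluates to 1 at \<open>s\<close>, but by \<open>lin\<close>
    this value is a combination of its values at elements of \<open>H\<close>, all zero.\<close>
  have "\<one> = tensor_eval R qs (\<lambda>x. x) (\<lambda>w. \<Oplus>g\<in>H. z g \<otimes> g w)"
    unfolding qs(2)[symmetric] using qs(1) lin by (intro tensor_eval_cong) auto
  also have "\<dots> = (\<Oplus>g\<in>H. z g \<otimes> tensor_eval R qs (\<lambda>x. x) g)"
    using qs(1) fin clH zc by (intro tensor_eval_sum) auto
  also have "\<dots> = \<zero>" using qs(3) zc by (simp add: add.finprod_one_eqI)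
  finally show False by simp
qed

end

section \<open>Automorphisms induced by units of subalgebras\<close>

locale field_in_ring = ring A for A (structure) +
  fixes F M :: "'a set"
  assumes M: "subfield M A" and FM: "F \<subseteq> M"
begin

abbreviation G where "G \<equiv> Galois_group A F M"

text \<open>The relation avoids the inverse of \<open>u\<close>, so that coefficients of its two
  sides can be compared and it makes sense for non-units too.\<close>

definition induced :: "'a set \<Rightarrow> ('a \<Rightarrow> 'a) set" where
  "induced B = {\<sigma> \<in> carrier G. \<exists>u \<in> Units (A\<lparr>carrier := B\<rparr>). \<forall>x\<in>M. u \<otimes> x = \<sigma> x \<otimes> u}"

text \<open>
  Here \<open>u\<close> need not be invertible: the coefficients of a unit of a generalized cyclic algebra are
  only known to be nonzero.
\<close>

definition intertwined :: "'a set \<Rightarrow> ('a \<Rightarrow> 'a) set" where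
  "intertwined B = {\<sigma> \<in> carrier G. \<exists>u \<in> B. u \<noteq> \<zero> \<and> (\<forall>x\<in>M. u \<otimes> x = \<sigma> x \<otimes> u)}"

lemma M_field: "field (A\<lparr>carrier := M\<rparr>)"
  using subfield_iff(2)[OF M] .

lemma M_carrier: "x \<in> M \<Longrightarrow> x \<in> carrier A"
  using subfieldE(3)[OF M] by auto

lemma carrier_G: "\<sigma> \<in> carrier G \<longleftrightarrow>
    \<sigma> \<in> Bij M \<and> \<sigma> \<in> ring_iso (A\<lparr>carrier := M\<rparr>) (A\<lparr>carrier := M\<rparr>) \<and> (\<forall>x\<in>F. \<sigma> x = x)"
  by (simp add: Galois_group_def)

lemma mult_G: "\<sigma> \<in> carrier G \<Longrightarrow> \<rho> \<in> carrier G \<Longrightarrow> \<sigma> \<otimes>\<^bsub>G\<^esub> \<rho> = compose M \<sigma> \<rho>"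
  by (simp add: Galois_group_def BijGroup_def)

lemma one_G: "\<one>\<^bsub>G\<^esub> = (\<lambda>x\<in>M. x)"
  by (simp add: Galois_group_def BijGroup_def)

lemma G_closed: "\<sigma> \<in> carrier G \<Longrightarrow> x \<in> M \<Longrightarrow> \<sigma> x \<in> M"
  unfolding carrier_G using Bij_imp_funcset by blast

lemma group_G: "group G"
proof -
  let ?L = "A\<lparr>carrier := M\<rparr>"
  interpret L: field ?L by (rule M_field)
  have "subgroup (carrier G) (BijGroup M)"
  proof (rule group.subgroupI[OF group_BijGroup])
    show "carrier G \<subseteq> carrier (BijGroup M)" by (auto simp: carrier_G BijGroup_def)
    have "(\<lambda>x\<in>M. x) \<in> carrier G"
      using FM id_Bij[of M] subringE(3,5,6,7)[OF subfieldE(1)[OF M]]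
      by (auto simp: carrier_G ring_iso_def ring_hom_def Bij_def)
    then show "carrier G \<noteq> {}" by blast
    fix \<sigma> assume s: "\<sigma> \<in> carrier G"
    let ?i = "\<lambda>x\<in>M. inv_into M \<sigma> x"
    have bij: "bij_betw \<sigma> M M" using s by (simp add: carrier_G Bij_def)
    have iso: "inv_into M \<sigma> \<in> ring_iso ?L ?L"
      using ring_iso_set_sym[OF L.ring_axioms, of \<sigma> ?L] s by (simp add: carrier_G)
    \<comment> \<open>Elements of \<open>G\<close> are extensional on \<open>M\<close>, so the
      inverse in \<open>BijGroup M\<close> is \<open>inv_into M \<sigma>\<close> restricted to
      \<open>M\<close>.\<close>
    have "?i \<in> ring_iso ?L ?L"
      by (rule L.ring_iso_restrict[OF iso]) simp
    moreover have "inv_into M \<sigma> x = x" if "x \<in> F" for x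
      using bij that FM s by (intro inv_into_f_eq) (auto simp: carrier_G bij_betw_def)
    ultimately show "inv\<^bsub>BijGroup M\<^esub> \<sigma> \<in> carrier G"
      using s FM inv_BijGroup[of \<sigma> M] restrict_inv_into_Bij[of \<sigma> M] by (auto simp: carrier_G)
  next
    fix \<sigma> \<rho> assume s: "\<sigma> \<in> carrier G" "\<rho> \<in> carrier G"
    have "\<sigma> \<circ> \<rho> \<in> ring_iso ?L ?L"
      using ring_iso_set_trans s by (auto simp: carrier_G)
    then have "compose M \<sigma> \<rho> \<in> ring_iso ?L ?L"
      by (rule L.ring_iso_restrict) (simp add: compose_def)
    moreover have "compose M \<sigma> \<rho> \<in> Bij M" using s by (simp add: carrier_G compose_Bij)
    ultimately show "\<sigma> \<otimes>\<^bsub>BijGroup M\<^esub> \<rho> \<in> carrier G"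
      using s FM by (auto simp: carrier_G BijGroup_def compose_def)
  qed
  then have "group (BijGroup M\<lparr>carrier := carrier G\<rparr>)"
    by (rule group.subgroup_imp_group[OF group_BijGroup])
  then show ?thesis by (simp add: Galois_group_def)
qed

sublocale G: group G by (rule group_G)

lemma G_mult_apply: "\<sigma> \<in> carrier G \<Longrightarrow> \<rho> \<in> carrier G \<Longrightarrow> x \<in> M \<Longrightarrow> (\<sigma> \<otimes>\<^bsub>G\<^esub> \<rho>) x = \<sigma> (\<rho> x)"
  by (simp add: mult_G compose_def)

lemma G_inv_apply:
  assumes "\<sigma> \<in> carrier G" "x \<in> M"
  shows "\<sigma> ((inv\<^bsub>G\<^esub> \<sigma>) x) = x" "(inv\<^bsub>G\<^esub> \<sigma>) (\<sigma> x) = x"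
  using G_mult_apply[of \<sigma> "inv\<^bsub>G\<^esub> \<sigma>" x] G_mult_apply[of "inv\<^bsub>G\<^esub> \<sigma>" \<sigma> x] assms
  by (simp_all add: one_G)

lemma induced_mono:
  assumes "B \<subseteq> C" shows "induced B \<subseteq> induced C"
proof -
  have "Units (A\<lparr>carrier := B\<rparr>) \<subseteq> Units (A\<lparr>carrier := C\<rparr>)" using assms by (auto simp: Units_def)
  then show ?thesis unfolding induced_def by blast
qed

lemma subgroup_induced:
  assumes B: "subring B A"
  shows "subgroup (induced B) G"
proof (rule G.subgroupI)
  interpret B: ring "A\<lparr>carrier := B\<rparr>" using subring_is_ring[OF B] .
  have BA: "u \<in> carrier A" if "u \<in> B" for u using subringE(1)[OF B] that by auto
  have UB: "u \<in> B" if "u \<in> Units (A\<lparr>carrier := B\<rparr>)" for u using that by (auto simp: Units_def)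
  show "induced B \<subseteq> carrier G" by (auto simp: induced_def)
  have "\<one>\<^bsub>G\<^esub> \<in> induced B"
    using B.Units_one_closed M_carrier G.one_closed
    by (auto simp: induced_def one_G simp del: G.one_closed intro!: bexI[of _ \<one>])
  then show "induced B \<noteq> {}" by blast
  fix \<sigma> assume "\<sigma> \<in> induced B"
  then obtain u where s: "\<sigma> \<in> carrier G" and u: "u \<in> Units (A\<lparr>carrier := B\<rparr>)"
    "\<And>x. x \<in> M \<Longrightarrow> u \<otimes> x = \<sigma> x \<otimes> u" by (auto simp: induced_def)
  obtain v where v: "v \<in> Units (A\<lparr>carrier := B\<rparr>)" "v \<otimes> u = \<one>" "u \<otimes> v = \<one>"
    using B.Units_inv_Units[OF u(1)] B.Units_l_inv[OF u(1)] B.Units_r_inv[OF u(1)] by auto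
  have uv: "u \<in> carrier A" "v \<in> carrier A" using UB[OF u(1)] UB[OF v(1)] BA by auto
  have "v \<otimes> x = (inv\<^bsub>G\<^esub> \<sigma>) x \<otimes> v" if x: "x \<in> M" for x
  proof -
    let ?y = "(inv\<^bsub>G\<^esub> \<sigma>) x"
    have y: "?y \<in> M" "\<sigma> ?y = x" using s x G_closed[of "inv\<^bsub>G\<^esub> \<sigma>" x] G_inv_apply by auto
    have c: "x \<in> carrier A" "?y \<in> carrier A" using x y(1) M_carrier by auto
    have "v \<otimes> x = v \<otimes> x \<otimes> (u \<otimes> v)" using v uv c by simp
    also have "\<dots> = v \<otimes> (u \<otimes> ?y) \<otimes> v" using u(2)[OF y(1)] y(2) uv c by (simp add: m_assoc)
    also have "\<dots> = (v \<otimes> u) \<otimes> ?y \<otimes> v" using uv c by (simp add: m_assoc)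
    also have "\<dots> = ?y \<otimes> v" using v uv c by simp
    finally show ?thesis .
  qed
  then show "inv\<^bsub>G\<^esub> \<sigma> \<in> induced B" using s v(1) by (auto simp: induced_def)
  fix \<rho> assume "\<rho> \<in> induced B"
  then obtain w where r: "\<rho> \<in> carrier G" and w: "w \<in> Units (A\<lparr>carrier := B\<rparr>)"
    "\<And>x. x \<in> M \<Longrightarrow> w \<otimes> x = \<rho> x \<otimes> w" by (auto simp: induced_def)
  have wc: "w \<in> carrier A" using UB[OF w(1)] BA by auto
  have "(u \<otimes> w) \<otimes> x = (\<sigma> \<otimes>\<^bsub>G\<^esub> \<rho>) x \<otimes> (u \<otimes> w)" if x: "x \<in> M" for x
  proof -
    have c: "x \<in> carrier A" "\<rho> x \<in> M" "\<rho> x \<in> carrier A" "\<sigma> (\<rho> x) \<in> carrier A"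
      using x r s M_carrier G_closed by auto
    have "(u \<otimes> w) \<otimes> x = (u \<otimes> \<rho> x) \<otimes> w" using w(2)[OF x] uv wc c by (simp add: m_assoc)
    also have "\<dots> = \<sigma> (\<rho> x) \<otimes> (u \<otimes> w)" using u(2)[OF c(2)] uv wc c by (simp add: m_assoc)
    finally show ?thesis using x r s by (simp add: G_mult_apply)
  qed
  moreover have "u \<otimes> w \<in> Units (A\<lparr>carrier := B\<rparr>)" using B.Units_m_closed[OF u(1) w(1)] by simp
  ultimately show "\<sigma> \<otimes>\<^bsub>G\<^esub> \<rho> \<in> induced B" using s r by (auto simp: induced_def)
qed

text \<open>Start of the induction: as \<open>M\<close> is commutative, the relation reads
  \<open>u x = u \<sigma>(x)\<close>, and the nonzero \<open>u\<close> cancels.\<close>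

lemma intertwined_M: "intertwined M \<subseteq> {\<one>\<^bsub>G\<^esub>}"
proof
  interpret L: field "A\<lparr>carrier := M\<rparr>" by (rule M_field)
  fix \<sigma> assume "\<sigma> \<in> intertwined M"
  then obtain u where s: "\<sigma> \<in> carrier G" and u: "u \<in> M" "u \<noteq> \<zero>"
    "\<And>x. x \<in> M \<Longrightarrow> u \<otimes> x = \<sigma> x \<otimes> u" by (auto simp: intertwined_def)
  have "\<sigma> x = x" if x: "x \<in> M" for x
  proof -
    have "u \<otimes> x = u \<otimes> \<sigma> x" using u x L.m_comm[of u "\<sigma> x"] G_closed[OF s x] by simp
    then show ?thesis using L.m_lcancel[of u x "\<sigma> x"] u x G_closed[OF s x] by simp
  qed
  then show "\<sigma> \<in> {\<one>\<^bsub>G\<^esub>}" using s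
    by (auto simp: one_G carrier_G Bij_def intro!: extensionalityI[of _ M])
qed

lemma induced_subset_intertwined:
  assumes "subring B A"
  shows "induced B \<subseteq> intertwined B"
proof
  fix \<sigma> assume "\<sigma> \<in> induced B"
  then obtain u where u: "\<sigma> \<in> carrier G" "u \<in> Units (A\<lparr>carrier := B\<rparr>)"
    "\<And>x. x \<in> M \<Longrightarrow> u \<otimes> x = \<sigma> x \<otimes> u" by (auto simp: induced_def)
  have "u \<noteq> \<zero>"
  proof
    assume "u = \<zero>"
    then obtain v where "v \<in> B" "v \<otimes> \<zero> = \<one>" using u(2) by (auto simp: Units_def)
    then show False using subringE(1)[OF assms] subfieldE(6)[OF M] by auto
  qed
  then show "\<sigma> \<in> intertwined B" using u by (auto simp: intertwined_def Units_def)
qed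

end

text \<open>One link of the chain. \<open>intertwined_B\<close> is the invariant carried along it: a
  nonzero coefficient in \<open>B\<close>, not known to be a unit, can be traded for a unit with the
  same effect on \<open>M\<close>.\<close>

locale generalized_cyclic_step = field_in_ring A F M for A (structure) and F M +
  fixes B C :: "'a set" and \<tau> q c
  assumes B: "subring B A" and C: "subring C A" and MB: "M \<subseteq> B" and BC: "B \<subseteq> C"
    and q: "2 \<le> q"
    and \<tau>: "\<tau> \<in> ring_iso (A\<lparr>carrier := B\<rparr>) (A\<lparr>carrier := B\<rparr>)"
    and \<tau>M: "restrict \<tau> M \<in> carrier G"
    and c: "c \<in> Units (A\<lparr>carrier := Fix (A\<lparr>carrier := B\<rparr>) \<tau>\<rparr>)"
    and gc: "is_generalized_cyclic_over (A\<lparr>carrier := C\<rparr>) (A\<lparr>carrier := B\<rparr>) \<tau> q c"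
    and intertwined_B: "intertwined B \<subseteq> induced B"
begin

definition "s = restrict \<tau> M"

lemma s_G: "s \<in> carrier G"
  using \<tau>M by (simp add: s_def)

lemma s_apply: "x \<in> M \<Longrightarrow> s x = \<tau> x"
  by (simp add: s_def)

lemma s_pow_apply: "x \<in> M \<Longrightarrow> (s [^]\<^bsub>G\<^esub> (j::nat)) x = (\<tau> ^^ j) x"
proof (induction j)
  case 0
  then show ?case by (simp add: one_G)
next
  case (Suc j)
  have "(s [^]\<^bsub>G\<^esub> Suc j) x = s ((s [^]\<^bsub>G\<^esub> j) x)"
    unfolding G.nat_pow_Suc2[OF s_G] using s_G Suc.prems by (simp add: G_mult_apply)
  moreover have "(s [^]\<^bsub>G\<^esub> j) x \<in> M" using G_closed[of "s [^]\<^bsub>G\<^esub> j"] s_G Suc.prems by simp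
  ultimately show ?case using Suc by (simp add: s_apply del: G.nat_pow_Suc)
qed

text \<open>Applying \<open>\<tau>\<close> to \<open>w \<otimes> x = \<rho> x \<otimes> w\<close>
  shows that the unit \<open>\<tau> w\<close> induces the conjugate.\<close>

lemma conj_induced:
  assumes "\<rho> \<in> induced B"
  shows "s \<otimes>\<^bsub>G\<^esub> \<rho> \<otimes>\<^bsub>G\<^esub> inv\<^bsub>G\<^esub> s \<in> induced B"
proof -
  let ?S = "A\<lparr>carrier := B\<rparr>"
  interpret S: ring ?S using subring_is_ring[OF B] .
  have h: "\<tau> \<in> ring_hom ?S ?S" using \<tau> by (simp add: ring_iso_def)
  have th: "\<tau> (x \<otimes> y) = \<tau> x \<otimes> \<tau> y" "\<tau> x \<in> B" if "x \<in> B" "y \<in> B" for x y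
    using ring_hom_memE(1,2)[OF h] that by auto
  have t1: "\<tau> \<one> = \<one>" using ring_hom_memE(4)[OF h] by simp
  obtain w where r: "\<rho> \<in> carrier G" and w: "w \<in> Units ?S"
    "\<And>x. x \<in> M \<Longrightarrow> w \<otimes> x = \<rho> x \<otimes> w" using assms by (auto simp: induced_def)
  have wB: "w \<in> B" using w(1) by (auto simp: Units_def)
  have tw: "\<tau> w \<in> Units ?S"
  proof -
    obtain v where "v \<in> B" "v \<otimes> w = \<one>" "w \<otimes> v = \<one>" using w(1) by (auto simp: Units_def)
    then show ?thesis using wB th[of v w] th[of w v] t1 by (auto simp: Units_def intro!: bexI[of _ "\<tau> v"])
  qed
  have "\<tau> w \<otimes> y = (s \<otimes>\<^bsub>G\<^esub> \<rho> \<otimes>\<^bsub>G\<^esub> inv\<^bsub>G\<^esub> s) y \<otimes> \<tau> w" if y: "y \<in> M" for y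
  proof -
    define x where "x = (inv\<^bsub>G\<^esub> s) y"
    have x: "x \<in> M" "\<tau> x = y"
      using G_closed[of "inv\<^bsub>G\<^esub> s" y] G_inv_apply(1)[OF s_G y] y s_G s_apply[of x]
      unfolding x_def by auto
    have rx: "\<rho> x \<in> M" using G_closed[OF r x(1)] .
    have "\<tau> w \<otimes> y = \<tau> (w \<otimes> x)" using th(1)[OF wB, of x] x MB by auto
    also have "\<dots> = \<tau> (\<rho> x) \<otimes> \<tau> w" using w(2)[OF x(1)] th(1)[of "\<rho> x" w] rx MB wB by auto
    also have "\<tau> (\<rho> x) = (s \<otimes>\<^bsub>G\<^esub> \<rho> \<otimes>\<^bsub>G\<^esub> inv\<^bsub>G\<^esub> s) y"
      using y x rx r s_G by (simp add: G_mult_apply x_def[symmetric] s_apply)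
    finally show ?thesis .
  qed
  then show ?thesis using tw r s_G by (auto simp: induced_def)
qed

text \<open>Coefficient \<open>j\<close> of \<open>u x = \<rho>(x) u\<close> gives
  \<open>\<kappa> u j (\<tau> ^^ j) x = \<rho>(x) \<kappa> u j\<close>. Where
  \<open>\<kappa> u j\<close> is nonzero, \<open>\<rho> s^-j\<close> thus lies in
  \<open>intertwined B\<close> and by \<open>intertwined_B\<close> comes from a unit of
  \<open>B\<close>; the unit \<open>t\<close> induces \<open>s\<close>.\<close>

lemma
  shows intertwined_subset_induced: "intertwined C \<subseteq> induced C"
    and induced_cosets: "\<And>\<rho>. \<rho> \<in> induced C \<Longrightarrow> \<exists>h\<in>induced B. \<exists>j<q. \<rho> = h \<otimes>\<^bsub>G\<^esub> s [^]\<^bsub>G\<^esub> j"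
    and commuting: "\<And>x. x \<in> M \<Longrightarrow> (\<And>b. b \<in> B \<Longrightarrow> b \<otimes> x = x \<otimes> b) \<Longrightarrow>
      (\<And>h. h \<in> induced C \<Longrightarrow> h x = x) \<Longrightarrow> u \<in> C \<Longrightarrow> u \<otimes> x = x \<otimes> u"
proof -
  have BA: "u \<in> carrier A" if "u \<in> B" for u using subringE(1)[OF B] that by auto
  obtain \<kappa> :: "'a \<Rightarrow> nat \<Rightarrow> 'a" and t where
    *: "\<forall>u\<in>C. \<forall>j. \<kappa> u j \<in> B" "\<forall>u\<in>C. u \<noteq> \<zero> \<longrightarrow> (\<exists>j<q. \<kappa> u j \<noteq> \<zero>)"
      "inj_on \<kappa> C" "\<forall>x\<in>B. \<forall>u\<in>C. \<forall>j. \<kappa> (x \<otimes> u) j = x \<otimes> \<kappa> u j"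
      "\<forall>x\<in>B. \<forall>u\<in>C. \<forall>j. \<kappa> (u \<otimes> x) j = \<kappa> u j \<otimes> (\<tau> ^^ j) x"
      "t \<in> Units (A\<lparr>carrier := C\<rparr>)" "\<forall>x\<in>B. t \<otimes> x = \<tau> x \<otimes> t"
    using generalized_cyclic_coefficients[OF ring_axioms B C BC subfieldE(6)[OF M] q gc c]
    by (elim exE conjE) (rule that)
  note \<kappa>B = *(1)[rule_format] and \<kappa>nz = *(2)[rule_format] and \<kappa>inj = *(3)
    and \<kappa>l = *(4)[rule_format] and \<kappa>r = *(5)[rule_format] and t = *(6) *(7)[rule_format]
  have sC: "s \<in> induced C" using t MB s_G s_apply by (auto simp: induced_def)
  \<comment> \<open>Stated for \<open>intertwined C\<close>, which contains
    \<open>induced C\<close>, so as to serve the first two claims.\<close>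
  have cosets: "\<exists>h\<in>induced B. \<exists>j<q. \<rho> = h \<otimes>\<^bsub>G\<^esub> s [^]\<^bsub>G\<^esub> j" if r: "\<rho> \<in> intertwined C" for \<rho>
  proof -
    obtain u where rG: "\<rho> \<in> carrier G" and u: "u \<in> C" "u \<noteq> \<zero>" "\<And>x. x \<in> M \<Longrightarrow> u \<otimes> x = \<rho> x \<otimes> u"
      using r by (auto simp: intertwined_def)
    obtain j where j: "j < q" "\<kappa> u j \<noteq> \<zero>" using \<kappa>nz[OF u(1,2)] by blast
    let ?sj = "s [^]\<^bsub>G\<^esub> j"
    have sj: "?sj \<in> carrier G" using s_G by simp
    define h where "h = \<rho> \<otimes>\<^bsub>G\<^esub> inv\<^bsub>G\<^esub> ?sj"
    have hG: "h \<in> carrier G" using rG sj by (simp add: h_def)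
    have "\<kappa> u j \<otimes> y = h y \<otimes> \<kappa> u j" if y: "y \<in> M" for y
    proof -
      define x where "x = (inv\<^bsub>G\<^esub> ?sj) y"
      have x: "x \<in> M" "(\<tau> ^^ j) x = y"
        using G_closed[of "inv\<^bsub>G\<^esub> ?sj" y] G_inv_apply(1)[OF sj y] y sj s_pow_apply[of x j]
        unfolding x_def by auto
      have rx: "\<rho> x \<in> M" using G_closed[OF rG x(1)] .
      have "\<kappa> u j \<otimes> y = \<kappa> (u \<otimes> x) j" using \<kappa>r[of x u j] x MB u(1) by auto
      also have "\<dots> = \<rho> x \<otimes> \<kappa> u j" using u(3)[OF x(1)] \<kappa>l[of "\<rho> x" u j] rx MB u(1) by auto
      also have "\<rho> x = h y" using y rG sj by (simp add: h_def x_def G_mult_apply)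
      finally show ?thesis .
    qed
    then have "h \<in> intertwined B" using hG j(2) \<kappa>B[OF u(1)] by (auto simp: intertwined_def)
    moreover have "\<rho> = h \<otimes>\<^bsub>G\<^esub> ?sj" using rG sj by (simp add: h_def G.m_assoc)
    ultimately show ?thesis using j(1) intertwined_B by blast
  qed
  show "intertwined C \<subseteq> induced C"
  proof
    fix \<rho> assume "\<rho> \<in> intertwined C"
    then obtain h j where h: "h \<in> induced B" "\<rho> = h \<otimes>\<^bsub>G\<^esub> s [^]\<^bsub>G\<^esub> (j::nat)" using cosets by blast
    interpret U: subgroup "induced C" G using subgroup_induced[OF C] .
    have "s [^]\<^bsub>G\<^esub> j \<in> induced C" by (induction j) (use sC in auto)
    then show "\<rho> \<in> induced C" using h induced_mono[OF BC] by auto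
  qed
  show "\<exists>h\<in>induced B. \<exists>j<q. \<rho> = h \<otimes>\<^bsub>G\<^esub> s [^]\<^bsub>G\<^esub> j" if "\<rho> \<in> induced C" for \<rho>
    using cosets induced_subset_intertwined[OF C] that by blast
  show "u \<otimes> x = x \<otimes> u" if x: "x \<in> M" and comm: "\<And>b. b \<in> B \<Longrightarrow> b \<otimes> x = x \<otimes> b"
    and fixed: "\<And>h. h \<in> induced C \<Longrightarrow> h x = x" and u: "u \<in> C" for x
  proof (rule inj_onD[OF \<kappa>inj])
    \<comment> \<open>Being fixed by \<open>s\<close>, \<open>x\<close> is fixed by every
      \<open>\<tau> ^^ j\<close>; so coefficient \<open>j\<close> of \<open>u x\<close> is
      \<open>\<kappa> u j x\<close>, which equals \<open>x \<kappa> u j\<close> by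
      \<open>comm\<close>.\<close>
    have "s x = x" using fixed[OF sC] .
    then have "\<tau> x = x" using s_apply[OF x] by simp
    then have "(\<tau> ^^ j) x = x" for j using x by (induction j) auto
    then have "\<kappa> (u \<otimes> x) j = \<kappa> (x \<otimes> u) j" for j
      using \<kappa>l[of x u j] \<kappa>r[of x u j] comm[OF \<kappa>B[OF u]] x MB u by auto
    then show "\<kappa> (u \<otimes> x) = \<kappa> (x \<otimes> u)" by blast
    show "u \<otimes> x \<in> C" "x \<otimes> u \<in> C" using x MB BC u subringE(6)[OF C] by auto
  qed
qed

end

section \<open>Units of the whole algebra induce the whole Galois group\<close>

context field_in_ring
begin

text \<open>By \<open>comm\<close> and \<open>center\<close> the common fixed points of the induced
  automorphisms lie in \<open>F\<close>, where every element of \<open>G\<close> is the identity, so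
  Artin's theorem applies to it.\<close>

lemma induced_carrier:
  assumes center: "ring_center A = F" and fin: "finite (induced (carrier A))"
    and comm: "\<And>x u. x \<in> M \<Longrightarrow> (\<And>h. h \<in> induced (carrier A) \<Longrightarrow> h x = x) \<Longrightarrow> u \<in> carrier A \<Longrightarrow>
      u \<otimes> x = x \<otimes> u"
  shows "induced (carrier A) = carrier G"
proof
  let ?H = "induced (carrier A)" and ?L = "A\<lparr>carrier := M\<rparr>"
  interpret L: field ?L by (rule M_field)
  have HG: "?H \<subseteq> carrier G" by (auto simp: induced_def)
  then show "?H \<subseteq> carrier G" .
  interpret H: subgroup ?H G using subgroup_induced[OF carrier_is_subring] .
  show "carrier G \<subseteq> ?H"
  proof
    fix \<sigma> assume s: "\<sigma> \<in> carrier G"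
    show "\<sigma> \<in> ?H"
    proof (rule L.Artin_fixed_field[OF fin])
      show "?H \<subseteq> ring_hom ?L ?L" "?H \<subseteq> extensional (carrier ?L)"
        using HG by (auto simp: carrier_G Bij_def ring_iso_def)
      show "\<sigma> \<in> ring_hom ?L ?L" "\<sigma> \<in> extensional (carrier ?L)"
        using s by (auto simp: carrier_G Bij_def ring_iso_def)
      show "(\<lambda>x\<in>carrier ?L. x) \<in> ?H" using H.one_closed by (simp add: one_G)
      \<comment> \<open>Left translation by \<open>k\<close> is injective, hence surjective on the
        finite set \<open>?H\<close>.\<close>
      show "bij_betw (compose (carrier ?L) k) ?H ?H" if k: "k \<in> ?H" for k
      proof -
        have eq: "compose (carrier ?L) k g = k \<otimes>\<^bsub>G\<^esub> g" if "g \<in> ?H" for g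
          using mult_G[of k g] k that HG by auto
        have inj: "inj_on (compose (carrier ?L) k) ?H"
          using eq k HG by (auto simp: inj_on_def subset_iff)
        moreover have "compose (carrier ?L) k ` ?H \<subseteq> ?H" using eq k by auto
        ultimately show ?thesis using endo_inj_surj[OF fin] by (simp add: bij_betw_def)
      qed
      show "\<sigma> x = x" if "x \<in> carrier ?L" "\<And>h. h \<in> ?H \<Longrightarrow> h x = x" for x
      proof -
        have "x \<in> ring_center A" using that comm[of x] M_carrier by (auto simp: ring_center_def)
        then show ?thesis using center s by (auto simp: carrier_G)
      qed
    qed
  qed
qed

end

text \<open>If \<open>k\<close> and \<open>k'\<close> have exponents \<open>i\<close> and
  \<open>j\<close>, both \<open>k k'\<close> and \<open>k' k\<close> lie in
  \<open>H s^(i+j)\<close>; the commutator is the first times the inverse of the second, so the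
  powers of \<open>s\<close> cancel. Only nonnegative powers of \<open>s\<close> move past
  \<open>H\<close>, and for these \<open>conj\<close> suffices.\<close>

lemma (in group) derived_of_cyclic_extension:
  assumes H: "subgroup H G" and s: "s \<in> carrier G"
    and conj: "\<And>h. h \<in> H \<Longrightarrow> s \<otimes> h \<otimes> inv s \<in> H"
    and K: "\<And>k. k \<in> K \<Longrightarrow> \<exists>h\<in>H. \<exists>j::nat. k = h \<otimes> s [^] j"
  shows "derived G K \<subseteq> H"
proof -
  have Hc: "h \<in> carrier G" if "h \<in> H" for h using subgroup.mem_carrier[OF H that] .
  have pow: "\<exists>h'\<in>H. s [^] j \<otimes> h = h' \<otimes> s [^] j" if "h \<in> H" for h and j :: nat
  proof (induction j)
    case (Suc j)
    then obtain h' where h': "h' \<in> H" "s [^] j \<otimes> h = h' \<otimes> s [^] j" by blast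
    have "s [^] Suc j \<otimes> h = s \<otimes> (s [^] j \<otimes> h)"
      using s Hc[OF that] by (simp only: nat_pow_Suc2 m_assoc nat_pow_closed)
    also have "\<dots> = (s \<otimes> h' \<otimes> inv s) \<otimes> s [^] Suc j"
      unfolding h'(2) using s Hc[OF h'(1)]
      by (simp only: nat_pow_Suc2 m_assoc nat_pow_closed inv_closed m_closed)
        (simp add: m_assoc[symmetric])
    finally show ?case using conj[OF h'(1)] by blast
  qed (use that Hc in auto)
  have mult: "\<exists>h\<in>H. k \<otimes> k' = h \<otimes> s [^] (i + j)"
    if hk: "h \<in> H" "k = h \<otimes> s [^] i" "h' \<in> H" "k' = h' \<otimes> s [^] j" for h h' k k' and i j :: nat
  proof -
    obtain h'' where h'': "h'' \<in> H" "s [^] i \<otimes> h' = h'' \<otimes> s [^] i" using pow[OF hk(3)] by blast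
    have "k \<otimes> k' = h \<otimes> (s [^] i \<otimes> h') \<otimes> s [^] j"
      using s Hc hk by (simp add: m_assoc)
    also have "\<dots> = (h \<otimes> h'') \<otimes> s [^] (i + j)"
      unfolding h''(2) using s Hc hk h'' by (simp add: m_assoc nat_pow_mult[symmetric])
    finally show ?thesis using subgroup.m_closed[OF H hk(1) h''(1)] by blast
  qed
  have "derived_set G K \<subseteq> H"
  proof
    fix x assume "x \<in> derived_set G K"
    then obtain k k' where k: "k \<in> K" "k' \<in> K" "x = k \<otimes> k' \<otimes> inv k \<otimes> inv k'" by blast
    obtain h i h' j where h: "h \<in> H" "k = h \<otimes> s [^] (i::nat)" "h' \<in> H" "k' = h' \<otimes> s [^] (j::nat)"
      using K k(1,2) by meson
    have kc: "k \<in> carrier G" "k' \<in> carrier G" using h s Hc by auto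
    obtain a where a: "a \<in> H" "k \<otimes> k' = a \<otimes> s [^] (i + j)" using mult[OF h] by blast
    obtain b where b: "b \<in> H" "k' \<otimes> k = b \<otimes> s [^] (j + i)" using mult[OF h(3,4,1,2)] by blast
    have "x = (k \<otimes> k') \<otimes> inv (k' \<otimes> k)" using k(3) kc by (simp add: inv_mult_group m_assoc)
    also have "\<dots> = a \<otimes> inv b"
      unfolding a(2) b(2) using Hc[OF a(1)] Hc[OF b(1)] s
      by (simp add: inv_mult_group m_assoc add.commute) (simp add: m_assoc[symmetric])
    finally show "x \<in> H" using a(1) b(1) H by (simp add: subgroup.m_closed subgroup.m_inv_closed)
  qed
  then show ?thesis unfolding derived_def by (rule generate_subgroup_incl[OF _ H])
qed


section \<open>Induction along the chain of subalgebras\<close>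

theorem corollary16:
  fixes A :: "('a, 'b) ring_scheme" and F M :: "'a set" and n :: nat
  assumes "crossed_product_algebra A F n M"
    and "\<exists>(k::nat) (B :: nat \<Rightarrow> 'a set).
      B 0 = M \<and> B k = carrier A \<and>
      (\<forall>i\<le>k. subring (B i) A \<and> F \<subseteq> B i \<and>
         maximal_subfield (A\<lparr>carrier := B i\<rparr>) (ring_center (A\<lparr>carrier := B i\<rparr>)) M) \<and>
      (\<forall>i<k. B i \<subseteq> B (Suc i) \<and>
         (\<exists>(q::nat) \<tau> c. prime q \<and>
            \<tau> \<in> ring_iso (A\<lparr>carrier := B i\<rparr>) (A\<lparr>carrier := B i\<rparr>) \<and> (\<forall>x\<in>F. \<tau> x = x) \<and>
            has_inner_order (A\<lparr>carrier := B i\<rparr>) \<tau> q \<and>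
            restrict \<tau> M \<in> carrier (Galois_group A F M) \<and>
            c \<in> Units (A\<lparr>carrier := Fix (A\<lparr>carrier := B i\<rparr>) \<tau>\<rparr>) \<and>
            is_generalized_cyclic_over (A\<lparr>carrier := B (Suc i)\<rparr>) (A\<lparr>carrier := B i\<rparr>) \<tau> q c))"
  shows "solvable (Galois_group A F M)"
proof -
  have csa: "central_simple_algebra A F" and max: "maximal_subfield A F M"
    using assms(1) by (auto simp: crossed_product_algebra_def csa_of_degree_def)
  have center: "ring_center A = F" using csa by (simp add: central_simple_algebra_def)
  interpret field_in_ring A F M
    using csa max
    by (simp add: central_simple_algebra_def maximal_subfield_def field_in_ring_def field_in_ring_axioms_def)
  obtain k and B :: "nat \<Rightarrow> 'a set" where B0: "B 0 = M" and Bk: "B k = carrier A"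
    and Bsub: "\<forall>i\<le>k. subring (B i) A \<and> F \<subseteq> B i \<and>
         maximal_subfield (A\<lparr>carrier := B i\<rparr>) (ring_center (A\<lparr>carrier := B i\<rparr>)) M"
    and Bstep: "\<forall>i<k. B i \<subseteq> B (Suc i) \<and>
         (\<exists>(q::nat) \<tau> c. prime q \<and>
            \<tau> \<in> ring_iso (A\<lparr>carrier := B i\<rparr>) (A\<lparr>carrier := B i\<rparr>) \<and> (\<forall>x\<in>F. \<tau> x = x) \<and>
            has_inner_order (A\<lparr>carrier := B i\<rparr>) \<tau> q \<and>
            restrict \<tau> M \<in> carrier G \<and>
            c \<in> Units (A\<lparr>carrier := Fix (A\<lparr>carrier := B i\<rparr>) \<tau>\<rparr>) \<and>
            is_generalized_cyclic_over (A\<lparr>carrier := B (Suc i)\<rparr>) (A\<lparr>carrier := B i\<rparr>) \<tau> q c)"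
    using assms(2) by (elim exE conjE) (rule that)
  have Bring: "subring (B i) A" if "i \<le> k" for i using Bsub that by blast
  \<comment> \<open>The clause on \<open>intertwined\<close> feeds the next link, the one on
    \<open>derived\<close> bounds the derived length by \<open>i\<close>, and finiteness and
    commutation are what Artin's theorem takes at the end.\<close>
  have "M \<subseteq> B i \<and> intertwined (B i) \<subseteq> induced (B i) \<and> finite (induced (B i)) \<and>
    (derived G ^^ i) (induced (B i)) \<subseteq> {\<one>\<^bsub>G\<^esub>} \<and>
    (\<forall>x\<in>M. (\<forall>h\<in>induced (B i). h x = x) \<longrightarrow> (\<forall>u\<in>B i. u \<otimes>\<^bsub>A\<^esub> x = x \<otimes>\<^bsub>A\<^esub> u))" if "i \<le> k" for i
    using that
  proof (induction i)
    case 0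
    have "\<one>\<^bsub>G\<^esub> \<in> induced M"
      using subgroup.one_closed[OF subgroup_induced] Bring[of 0] B0 by simp
    moreover have "induced M \<subseteq> {\<one>\<^bsub>G\<^esub>}"
      using induced_subset_intertwined[of M] intertwined_M Bring[of 0] B0 by auto
    moreover have "u \<otimes>\<^bsub>A\<^esub> x = x \<otimes>\<^bsub>A\<^esub> u" if "u \<in> M" "x \<in> M" for u x
      using subfieldE(4)[OF M] that by simp
    ultimately show ?case using B0 intertwined_M finite_subset[of "induced M" "{\<one>\<^bsub>G\<^esub>}"] by auto
  next
    case (Suc i)
    then have i: "i < k" "i \<le> k" by auto
    have IH: "M \<subseteq> B i" "intertwined (B i) \<subseteq> induced (B i)" "finite (induced (B i))"
      "(derived G ^^ i) (induced (B i)) \<subseteq> {\<one>\<^bsub>G\<^esub>}"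
      "\<And>x u. x \<in> M \<Longrightarrow> (\<And>h. h \<in> induced (B i) \<Longrightarrow> h x = x) \<Longrightarrow> u \<in> B i \<Longrightarrow> u \<otimes>\<^bsub>A\<^esub> x = x \<otimes>\<^bsub>A\<^esub> u"
      using Suc.IH[OF i(2)] by blast+
    obtain q :: nat and \<tau> c where st: "prime q"
      "\<tau> \<in> ring_iso (A\<lparr>carrier := B i\<rparr>) (A\<lparr>carrier := B i\<rparr>)" "restrict \<tau> M \<in> carrier G"
      "c \<in> Units (A\<lparr>carrier := Fix (A\<lparr>carrier := B i\<rparr>) \<tau>\<rparr>)"
      "is_generalized_cyclic_over (A\<lparr>carrier := B (Suc i)\<rparr>) (A\<lparr>carrier := B i\<rparr>) \<tau> q c"
      using Bstep[rule_format, OF i(1)] by (elim exE conjE) (rule that)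
    interpret generalized_cyclic_step A F M "B i" "B (Suc i)" \<tau> q c
      using st(2-) Bring[OF i(2)] Bring[OF Suc.prems] conjunct1[OF Bstep[rule_format, OF i(1)]]
        IH(1,2) prime_ge_2_nat[OF st(1)]
      by (intro generalized_cyclic_step.intro generalized_cyclic_step_axioms.intro field_in_ring_axioms)
    \<comment> \<open>Finitely many powers of \<open>s\<close> over a finite group keep the next
      group finite.\<close>
    have "induced (B (Suc i)) \<subseteq> (\<lambda>(h, j). h \<otimes>\<^bsub>G\<^esub> s [^]\<^bsub>G\<^esub> j) ` (induced (B i) \<times> {..<q})"
      using induced_cosets by fastforce
    then have fin: "finite (induced (B (Suc i)))" by (rule finite_subset) (simp add: IH(3))
    have "derived G (induced (B (Suc i))) \<subseteq> induced (B i)"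
      using G.derived_of_cyclic_extension[OF subgroup_induced[OF B] s_G conj_induced] induced_cosets
      by blast
    then have "(derived G ^^ i) (derived G (induced (B (Suc i)))) \<subseteq> {\<one>\<^bsub>G\<^esub>}"
      using G.mono_exp_of_derived[of _ "induced (B i)" i] IH(4) by blast
    then have "(derived G ^^ Suc i) (induced (B (Suc i))) \<subseteq> {\<one>\<^bsub>G\<^esub>}" by (simp add: funpow_swap1)
    \<comment> \<open>What is fixed by the larger group is fixed by \<open>induced (B i)\<close>, so
      by \<open>IH(5)\<close> it commutes with \<open>B i\<close>, as \<open>commuting\<close>
      asks.\<close>
    moreover have "u \<otimes>\<^bsub>A\<^esub> x = x \<otimes>\<^bsub>A\<^esub> u"
      if "x \<in> M" "\<forall>h\<in>induced (B (Suc i)). h x = x" "u \<in> B (Suc i)" for x u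
      using commuting[OF _ IH(5)] that induced_mono[OF BC] by blast
    ultimately show ?case using fin intertwined_subset_induced MB BC by blast
  qed
  note U = this[OF order_refl, unfolded Bk]
  have "induced (carrier A) = carrier G" using induced_carrier[OF center] U by blast
  then have "(derived G ^^ k) (carrier G) \<subseteq> {\<one>\<^bsub>G\<^esub>}" using U by simp
  \<comment> \<open>The criterion for solvability asks for equality with the trivial group, hence
    the reverse inclusion.\<close>
  moreover have "\<one>\<^bsub>G\<^esub> \<in> (derived G ^^ k) (carrier G)"
    using subgroup.one_closed[OF G.exp_of_derived_is_subgroup[OF G.subgroup_self]] .
  ultimately show ?thesis using G.solvable_iff_trivial_derived_seq by blast
qed

end
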